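(* Let $\mathbb{C}$ be a normal category, let $\mathbb{X}$ be a torsion-free subcategory of $\mathbb{C}$, i.e. the torsion-free part of a torsion theory $(\mathbb{Y},\mathbb{X})$ in $\mathbb{C}$, and let $t_K\colon T(K)\to K$ denote the counit of the coreflection of $\mathbb{C}$ onto $\mathbb{Y}$. Assume that for any normal monomorphism $k\colon K\to A$ in $\mathbb{C}$, the monomorphism $k\circ t_K\colon T(K)\to A$ is normal. Let $(\mathcal{E},\mathcal{M})$ be the reflective factorisation system on $\mathbb{C}$ associated with the reflection of $\mathbb{C}$ onto $\mathbb{X}$, and let $\mathcal{E}'$, $\mathcal{M}^*$, $\overline{\mathcal{E}}$, $\overline{\mathcal{M}}$ be the classes of morphisms defined in the context. Consider the following properties: \begin{enumerate} \item[(1)] for any object $B\in\mathbb{C}$, there exists an effective descent morphism $E\to B$ in $\mathbb{C}$ such that $E\in\mathbb{X}$; \item[(2)] $\mathcal{M}^*=\overline{\mathcal{M}}$; \item[(3)] $\mathcal{E}'=\overline{\mathcal{E}}$; \item[(4)] $(\mathcal{E}',\mathcal{M}^* )$ is a factorisation system on $\mathbb{C}$. \end{enumerate} Then the implications $(1)\Rightarrow(2)$, $(2)\Rightarrow(3)$ and $(2)\Rightarrow(4)$ hold. Moreover, if $\mathbb{C}$ has enough projectives with respect to effective descent morphisms, then $(2)\Rightarrow(1)$ holds as well.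
   Context: Categories. A pointed category is a category with a zero-object $0$ (an object both initial and terminal); $0$ also denotes the unique morphism between two given objects factoring through the zero-object. The kernel $\ker(f)\colon \mathrm{Ker}(f)\to A$ of $f\colon A\to B$ is the pullback along $f$ of $0\to B$; the cokernel of $k\colon K\to A$ is the pushout by $k$ of $K\to 0$. A normal monomorphism is a morphism that is the kernel of some morphism; a normal epimorphism is a morphism that is the cokernel of some morphism. A regular category is a finitely complete category in which any arrow factorises as a regular epimorphism followed by a monomorphism, these factorisations being pullback-stable. A normal category is a pointed regular category in which every regular epimorphism is a normal epimorphism. A short exact sequence $0\to K\xrightarrow{k}A\xrightarrow{f}B\to 0$ is a composable pair $(k,f)$ with $k=\ker(f)$ and $f=\mathrm{coker}(k)$. Torsion theories. A torsion theory in a pointed category $\mathbb{C}$ is a pair $(\mathbb{Y},\mathbb{X})$ of full and replete subcategories of $\mathbb{C}$ such that (i) $\mathrm{Hom}_{\mathbb{C}}(Y,X)=\{0\}$ for all $X\in\mathbb{X}$, $Y\in\mathbb{Y}$; and (ii) for every $A\in\mathbb{C}$ there is a short exact sequence $0\to Y\to A\to X\to 0$ with $Y\in\mathbb{Y}$ and $X\in\mathbb{X}$. $\mathbb{Y}$ is the torsion part and $\mathbb{X}$ the torsion-free part. The sequence in (ii) is unique up to isomorphism and is written $0\to T(A)\xrightarrow{t_A}A\xrightarrow{\eta_A}HI(A)\to 0$; here $H\colon\mathbb{X}\to\mathbb{C}$ is the inclusion, $I\colon\mathbb{C}\to\mathbb{X}$ is its left adjoint (the reflector) with unit $\eta$,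 and $T$ gives the coreflection of $\mathbb{C}$ onto $\mathbb{Y}$ with counit $t$. Factorisation systems. For morphisms $e\colon A\to B$ and $m\colon C\to D$, write $e\downarrow m$ if for every commutative square $m\circ a=b\circ e$ (with $a\colon A\to C$, $b\colon B\to D$) there is a unique $d\colon B\to C$ with $d\circ e=a$ and $m\circ d=b$. For a class $\mathcal{A}$ of morphisms put $\mathcal{A}^{\downarrow}=\{m\mid e\downarrow m \text{ for all } e\in\mathcal{A}\}$ and $\mathcal{A}^{\uparrow}=\{e\mid e\downarrow m\text{ for all }m\in\mathcal{A}\}$. A pair $(\mathcal{A},\mathcal{B})$ of classes of morphisms of $\mathbb{C}$ is a factorisation system on $\mathbb{C}$ if $\mathcal{A}=\mathcal{B}^{\uparrow}$, $\mathcal{B}=\mathcal{A}^{\downarrow}$, and every morphism $f$ of $\mathbb{C}$ can be written $f=m\circ e$ with $e\in\mathcal{A}$, $m\in\mathcal{B}$. The reflective factorisation system $(\mathcal{E},\mathcal{M})$ associated with $\mathbb{X}$ is: $\mathcal{E}$ is the class of morphisms inverted by $I$ (sent to isomorphisms), and $\mathcal{M}$ is the closure under pullback (along arbitrary morphisms of $\mathbb{C}$) of the class of all morphisms in the image of $H$. (For a torsion-free subcategory of a normal category this is indeed a factorisation system.) Effective descent. A morphism $p\colon E\to B$ is an effective descent morphism if the pullback functor $p^*\colon(\mathbb{C}\downarrow B)\to(\mathbb{C}\downarrow E)$ is monadic. An object $P$ is projective with respect to effective descent morphisms if for every effective descent morphism $p\colon E\to B$ every morphism $P\to B$ factors through $p$;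 $\mathbb{C}$ has enough projectives with respect to effective descent morphisms if for every object $B$ there is an effective descent morphism $E\to B$ with $E$ projective in this sense. Classes of morphisms. $\mathcal{E}'$ is the class of morphisms stably in $\mathcal{E}$, i.e. those morphisms every pullback of which is in $\mathcal{E}$. $\mathcal{M}^*$ is the class of morphisms locally in $\mathcal{M}$, i.e. morphisms $f\colon A\to B$ for which there exists an effective descent morphism $p\colon E\to B$ such that the pullback $p^*(f)\colon E\times_B A\to E$ is in $\mathcal{M}$. $\overline{\mathcal{E}}$ is the class of all normal epimorphisms $f\colon A\to B$ in $\mathbb{C}$ with $\mathrm{Ker}(f)\in\mathbb{Y}$. $\overline{\mathcal{M}}$ is the class of all morphisms $f\colon A\to B$ in $\mathbb{C}$ with $\mathrm{Ker}(f)\in\mathbb{X}$. *)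

theory Defs
  imports Main
begin

section \<open>Categories\<close>

record ('o, 'm) cat =
  Ob :: "'o set"
  Ar :: "'m set"
  Dom :: "'m \<Rightarrow> 'o"
  Cod :: "'m \<Rightarrow> 'o"
  Idt :: "'o \<Rightarrow> 'm"
  Cmp :: "'m \<Rightarrow> 'm \<Rightarrow> 'm"  (infixl "\<cdot>\<index>" 70)

definition hom :: "('o, 'm) cat \<Rightarrow> 'o \<Rightarrow> 'o \<Rightarrow> 'm set" where
  "hom C A B = {f \<in> Ar C. Dom C f = A \<and> Cod C f = B}"

locale category =
  fixes C :: "('o, 'm) cat" (structure)
  assumes Dom_in: "f \<in> Ar C \<Longrightarrow> Dom C f \<in> Ob C"
    and Cod_in: "f \<in> Ar C \<Longrightarrow> Cod C f \<in> Ob C"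
    and Idt_in: "A \<in> Ob C \<Longrightarrow> Idt C A \<in> hom C A A"
    and Cmp_in: "f \<in> hom C A B \<Longrightarrow> g \<in> hom C B D \<Longrightarrow> g \<cdot> f \<in> hom C A D"
    and Idt_right: "f \<in> hom C A B \<Longrightarrow> f \<cdot> Idt C A = f"
    and Idt_left: "f \<in> hom C A B \<Longrightarrow> Idt C B \<cdot> f = f"
    and Cmp_assoc: "f \<in> hom C A B \<Longrightarrow> g \<in> hom C B D \<Longrightarrow> h \<in> hom C D E
                      \<Longrightarrow> (h \<cdot> g) \<cdot> f = h \<cdot> (g \<cdot> f)"

definition mono :: "('o, 'm) cat \<Rightarrow> 'm \<Rightarrow> bool" where
  "mono C m \<longleftrightarrow> m \<in> Ar C \<and>
     (\<forall>A. \<forall>f \<in> hom C A (Dom C m). \<forall>g \<in> hom C A (Dom C m).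
        m \<cdot>\<^bsub>C\<^esub> f = m \<cdot>\<^bsub>C\<^esub> g \<longrightarrow> f = g)"

definition iso :: "('o, 'm) cat \<Rightarrow> 'm \<Rightarrow> bool" where
  "iso C f \<longleftrightarrow> f \<in> Ar C \<and>
     (\<exists>g \<in> hom C (Cod C f) (Dom C f).
        g \<cdot>\<^bsub>C\<^esub> f = Idt C (Dom C f) \<and> f \<cdot>\<^bsub>C\<^esub> g = Idt C (Cod C f))"

definition isomorphic :: "('o, 'm) cat \<Rightarrow> 'o \<Rightarrow> 'o \<Rightarrow> bool" where
  "isomorphic C A B \<longleftrightarrow> (\<exists>f \<in> hom C A B. iso C f)"

definition initial :: "('o, 'm) cat \<Rightarrow> 'o \<Rightarrow> bool" where
  "initial C Z \<longleftrightarrow> Z \<in> Ob C \<and> (\<forall>A \<in> Ob C. \<exists>!f. f \<in> hom C Z A)"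

definition terminal :: "('o, 'm) cat \<Rightarrow> 'o \<Rightarrow> bool" where
  "terminal C Z \<longleftrightarrow> Z \<in> Ob C \<and> (\<forall>A \<in> Ob C. \<exists>!f. f \<in> hom C A Z)"

definition zero_object :: "('o, 'm) cat \<Rightarrow> 'o \<Rightarrow> bool" where
  "zero_object C Z \<longleftrightarrow> initial C Z \<and> terminal C Z"

definition pointed :: "('o, 'm) cat \<Rightarrow> bool" where
  "pointed C \<longleftrightarrow> category C \<and> (\<exists>Z. zero_object C Z)"

definition zero_arrow :: "('o, 'm) cat \<Rightarrow> 'm \<Rightarrow> bool" where
  "zero_arrow C f \<longleftrightarrow> f \<in> Ar C \<and>
     (\<exists>Z. zero_object C Z \<and>
        (\<exists>u \<in> hom C (Dom C f) Z. \<exists>v \<in> hom C Z (Cod C f). f = v \<cdot>\<^bsub>C\<^esub> u))"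

text \<open>\<open>is_pullback C f g p q\<close>: the square \<open>f \<cdot> p = g \<cdot> q\<close> is a pullback, so \<open>q\<close> is a
  pullback of \<open>f\<close> along \<open>g\<close> and \<open>p\<close> is a pullback of \<open>g\<close> along \<open>f\<close>.
  \<open>is_pushout C f g i j\<close>: the square \<open>i \<cdot> f = j \<cdot> g\<close> is a pushout.\<close>

definition is_pullback :: "('o, 'm) cat \<Rightarrow> 'm \<Rightarrow> 'm \<Rightarrow> 'm \<Rightarrow> 'm \<Rightarrow> bool" where
  "is_pullback C f g p q \<longleftrightarrow>
     {f, g, p, q} \<subseteq> Ar C \<and> Cod C f = Cod C g \<and> Dom C p = Dom C q \<and>
     Cod C p = Dom C f \<and> Cod C q = Dom C g \<and> f \<cdot>\<^bsub>C\<^esub> p = g \<cdot>\<^bsub>C\<^esub> q \<and>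
     (\<forall>W. \<forall>a \<in> hom C W (Dom C f). \<forall>b \<in> hom C W (Dom C g).
        f \<cdot>\<^bsub>C\<^esub> a = g \<cdot>\<^bsub>C\<^esub> b \<longrightarrow>
        (\<exists>!u. u \<in> hom C W (Dom C p) \<and> p \<cdot>\<^bsub>C\<^esub> u = a \<and> q \<cdot>\<^bsub>C\<^esub> u = b))"

definition is_pushout :: "('o, 'm) cat \<Rightarrow> 'm \<Rightarrow> 'm \<Rightarrow> 'm \<Rightarrow> 'm \<Rightarrow> bool" where
  "is_pushout C f g i j \<longleftrightarrow>
     {f, g, i, j} \<subseteq> Ar C \<and> Dom C f = Dom C g \<and> Cod C i = Cod C j \<and>
     Dom C i = Cod C f \<and> Dom C j = Cod C g \<and> i \<cdot>\<^bsub>C\<^esub> f = j \<cdot>\<^bsub>C\<^esub> g \<and>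
     (\<forall>W. \<forall>a \<in> hom C (Cod C f) W. \<forall>b \<in> hom C (Cod C g) W.
        a \<cdot>\<^bsub>C\<^esub> f = b \<cdot>\<^bsub>C\<^esub> g \<longrightarrow>
        (\<exists>!u. u \<in> hom C (Cod C i) W \<and> u \<cdot>\<^bsub>C\<^esub> i = a \<and> u \<cdot>\<^bsub>C\<^esub> j = b))"

definition is_coequaliser :: "('o, 'm) cat \<Rightarrow> 'm \<Rightarrow> 'm \<Rightarrow> 'm \<Rightarrow> bool" where
  "is_coequaliser C g h f \<longleftrightarrow>
     {g, h, f} \<subseteq> Ar C \<and> Dom C g = Dom C h \<and> Cod C g = Cod C h \<and> Dom C f = Cod C g \<and>
     f \<cdot>\<^bsub>C\<^esub> g = f \<cdot>\<^bsub>C\<^esub> h \<and>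
     (\<forall>W. \<forall>a \<in> hom C (Dom C f) W. a \<cdot>\<^bsub>C\<^esub> g = a \<cdot>\<^bsub>C\<^esub> h \<longrightarrow>
        (\<exists>!u. u \<in> hom C (Cod C f) W \<and> u \<cdot>\<^bsub>C\<^esub> f = a))"

definition regular_epi :: "('o, 'm) cat \<Rightarrow> 'm \<Rightarrow> bool" where
  "regular_epi C f \<longleftrightarrow> (\<exists>g h. is_coequaliser C g h f)"

definition is_kernel :: "('o, 'm) cat \<Rightarrow> 'm \<Rightarrow> 'm \<Rightarrow> bool" where
  "is_kernel C k f \<longleftrightarrow> (\<exists>z t. zero_object C (Dom C z) \<and> is_pullback C f z k t)"

definition is_cokernel :: "('o, 'm) cat \<Rightarrow> 'm \<Rightarrow> 'm \<Rightarrow> bool" where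
  "is_cokernel C f k \<longleftrightarrow> (\<exists>z t. zero_object C (Cod C t) \<and> is_pushout C k t f z)"

definition normal_mono :: "('o, 'm) cat \<Rightarrow> 'm \<Rightarrow> bool" where
  "normal_mono C k \<longleftrightarrow> (\<exists>f. is_kernel C k f)"

definition normal_epi :: "('o, 'm) cat \<Rightarrow> 'm \<Rightarrow> bool" where
  "normal_epi C f \<longleftrightarrow> (\<exists>k. is_cokernel C f k)"

definition short_exact :: "('o, 'm) cat \<Rightarrow> 'm \<Rightarrow> 'm \<Rightarrow> bool" where
  "short_exact C k f \<longleftrightarrow> is_kernel C k f \<and> is_cokernel C f k"


section \<open>Functors, adjunctions, monadicity\<close>

record ('a, 'b, 'c, 'd) ftor =
  on_ob :: "'a \<Rightarrow> 'c"
  on_ar :: "'b \<Rightarrow> 'd"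

definition is_functor :: "('a, 'b) cat \<Rightarrow> ('c, 'd) cat \<Rightarrow> ('a, 'b, 'c, 'd) ftor \<Rightarrow> bool" where
  "is_functor A B F \<longleftrightarrow> category A \<and> category B \<and>
     (\<forall>x \<in> Ob A. on_ob F x \<in> Ob B) \<and>
     (\<forall>x y. \<forall>f \<in> hom A x y. on_ar F f \<in> hom B (on_ob F x) (on_ob F y)) \<and>
     (\<forall>x \<in> Ob A. on_ar F (Idt A x) = Idt B (on_ob F x)) \<and>
     (\<forall>x y z. \<forall>f \<in> hom A x y. \<forall>g \<in> hom A y z.
        on_ar F (g \<cdot>\<^bsub>A\<^esub> f) = on_ar F g \<cdot>\<^bsub>B\<^esub> on_ar F f)"

definition id_ftor :: "('a, 'b, 'a, 'b) ftor" where
  "id_ftor = \<lparr>on_ob = (\<lambda>x. x), on_ar = (\<lambda>f. f)\<rparr>"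

definition comp_ftor :: "('c, 'd, 'e, 'f) ftor \<Rightarrow> ('a, 'b, 'c, 'd) ftor \<Rightarrow> ('a, 'b, 'e, 'f) ftor" where
  "comp_ftor G F = \<lparr>on_ob = on_ob G \<circ> on_ob F, on_ar = on_ar G \<circ> on_ar F\<rparr>"

definition nat_trans ::
  "('a, 'b) cat \<Rightarrow> ('c, 'd) cat \<Rightarrow> ('a, 'b, 'c, 'd) ftor \<Rightarrow> ('a, 'b, 'c, 'd) ftor \<Rightarrow> ('a \<Rightarrow> 'd) \<Rightarrow> bool"
where
  "nat_trans A B F G \<tau> \<longleftrightarrow> is_functor A B F \<and> is_functor A B G \<and>
     (\<forall>x \<in> Ob A. \<tau> x \<in> hom B (on_ob F x) (on_ob G x)) \<and>
     (\<forall>x y. \<forall>f \<in> hom A x y. \<tau> y \<cdot>\<^bsub>B\<^esub> on_ar F f = on_ar G f \<cdot>\<^bsub>B\<^esub> \<tau> x)"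

definition nat_iso ::
  "('a, 'b) cat \<Rightarrow> ('c, 'd) cat \<Rightarrow> ('a, 'b, 'c, 'd) ftor \<Rightarrow> ('a, 'b, 'c, 'd) ftor \<Rightarrow> ('a \<Rightarrow> 'd) \<Rightarrow> bool"
where
  "nat_iso A B F G \<tau> \<longleftrightarrow> nat_trans A B F G \<tau> \<and> (\<forall>x \<in> Ob A. iso B (\<tau> x))"

definition equivalence :: "('a, 'b) cat \<Rightarrow> ('c, 'd) cat \<Rightarrow> ('a, 'b, 'c, 'd) ftor \<Rightarrow> bool" where
  "equivalence A B F \<longleftrightarrow> is_functor A B F \<and>
     (\<exists>G \<alpha> \<beta>. is_functor B A G \<and> nat_iso A A id_ftor (comp_ftor G F) \<alpha> \<and>
        nat_iso B B (comp_ftor F G) id_ftor \<beta>)"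

text \<open>\<open>F : A \<rightarrow> B\<close> is left adjoint to \<open>G : B \<rightarrow> A\<close>, with unit \<open>\<eta>\<close> and counit \<open>\<epsilon>\<close>.\<close>

definition adjunction ::
  "('a, 'b) cat \<Rightarrow> ('c, 'd) cat \<Rightarrow> ('a, 'b, 'c, 'd) ftor \<Rightarrow> ('c, 'd, 'a, 'b) ftor
     \<Rightarrow> ('a \<Rightarrow> 'b) \<Rightarrow> ('c \<Rightarrow> 'd) \<Rightarrow> bool"
where
  "adjunction A B F G \<eta> \<epsilon> \<longleftrightarrow>
     is_functor A B F \<and> is_functor B A G \<and>
     nat_trans A A id_ftor (comp_ftor G F) \<eta> \<and>
     nat_trans B B (comp_ftor F G) id_ftor \<epsilon> \<and>
     (\<forall>x \<in> Ob A. \<epsilon> (on_ob F x) \<cdot>\<^bsub>B\<^esub> on_ar F (\<eta> x) = Idt B (on_ob F x)) \<and>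
     (\<forall>y \<in> Ob B. on_ar G (\<epsilon> y) \<cdot>\<^bsub>A\<^esub> \<eta> (on_ob G y) = Idt A (on_ob G y))"

text \<open>The Eilenberg--Moore category of the monad \<open>(T, \<eta>, \<mu>)\<close> on \<open>A\<close>. An arrow carries its domain
  and codomain algebras, since the underlying arrow of \<open>A\<close> does not determine them.\<close>

definition em_cat ::
  "('a, 'b) cat \<Rightarrow> ('a, 'b, 'a, 'b) ftor \<Rightarrow> ('a \<Rightarrow> 'b) \<Rightarrow> ('a \<Rightarrow> 'b)
     \<Rightarrow> ('a \<times> 'b, ('a \<times> 'b) \<times> 'b \<times> ('a \<times> 'b)) cat"
where
  "em_cat A T \<eta> \<mu> =
    (let algs = {(x, a). x \<in> Ob A \<and> a \<in> hom A (on_ob T x) x \<and>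
                   a \<cdot>\<^bsub>A\<^esub> \<eta> x = Idt A x \<and> a \<cdot>\<^bsub>A\<^esub> on_ar T a = a \<cdot>\<^bsub>A\<^esub> \<mu> x}
     in \<lparr>Ob = algs,
         Ar = {((x, a), h, (y, b)). (x, a) \<in> algs \<and> (y, b) \<in> algs \<and> h \<in> hom A x y \<and>
                 h \<cdot>\<^bsub>A\<^esub> a = b \<cdot>\<^bsub>A\<^esub> on_ar T h},
         Dom = (\<lambda>(X, h, Y). X),
         Cod = (\<lambda>(X, h, Y). Y),
         Idt = (\<lambda>X. (X, Idt A (fst X), X)),
         Cmp = (\<lambda>(Y, g, Z) (X, f, Y'). (X, g \<cdot>\<^bsub>A\<^esub> f, Z))\<rparr>)"

definition comparison ::
  "('c, 'd) cat \<Rightarrow> ('c, 'd, 'a, 'b) ftor \<Rightarrow> ('c \<Rightarrow> 'd)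
     \<Rightarrow> ('c, 'd, 'a \<times> 'b, ('a \<times> 'b) \<times> 'b \<times> ('a \<times> 'b)) ftor"
where
  "comparison B G \<epsilon> =
    (let K = (\<lambda>y. (on_ob G y, on_ar G (\<epsilon> y)))
     in \<lparr>on_ob = K, on_ar = (\<lambda>f. (K (Dom B f), on_ar G f, K (Cod B f)))\<rparr>)"

definition monadic :: "('c, 'd) cat \<Rightarrow> ('a, 'b) cat \<Rightarrow> ('c, 'd, 'a, 'b) ftor \<Rightarrow> bool" where
  "monadic B A G \<longleftrightarrow>
     (\<exists>F \<eta> \<epsilon>. adjunction A B F G \<eta> \<epsilon> \<and>
        equivalence B (em_cat A (comp_ftor G F) \<eta> (\<lambda>x. on_ar G (\<epsilon> (on_ob F x))))
          (comparison B G \<epsilon>))"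


section \<open>Normal categories\<close>

definition is_cone ::
  "('i, 'j) cat \<Rightarrow> ('o, 'm) cat \<Rightarrow> ('i, 'j, 'o, 'm) ftor \<Rightarrow> 'o \<Rightarrow> ('i \<Rightarrow> 'm) \<Rightarrow> bool"
where
  "is_cone J C D L \<pi> \<longleftrightarrow> L \<in> Ob C \<and>
     (\<forall>j \<in> Ob J. \<pi> j \<in> hom C L (on_ob D j)) \<and>
     (\<forall>a \<in> Ar J. on_ar D a \<cdot>\<^bsub>C\<^esub> \<pi> (Dom J a) = \<pi> (Cod J a))"

definition is_limit ::
  "('i, 'j) cat \<Rightarrow> ('o, 'm) cat \<Rightarrow> ('i, 'j, 'o, 'm) ftor \<Rightarrow> 'o \<Rightarrow> ('i \<Rightarrow> 'm) \<Rightarrow> bool"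
where
  "is_limit J C D L \<pi> \<longleftrightarrow> is_cone J C D L \<pi> \<and>
     (\<forall>W \<sigma>. is_cone J C D W \<sigma> \<longrightarrow>
        (\<exists>!u. u \<in> hom C W L \<and> (\<forall>j \<in> Ob J. \<pi> j \<cdot>\<^bsub>C\<^esub> u = \<sigma> j)))"

text \<open>Every finite category is isomorphic to one whose objects and arrows are natural numbers, so
  the restriction to index categories of type \<open>(nat, nat) cat\<close> loses nothing.\<close>

definition finitely_complete :: "('o, 'm) cat \<Rightarrow> bool" where
  "finitely_complete C \<longleftrightarrow> category C \<and>
     (\<forall>(J :: (nat, nat) cat) D. finite (Ob J) \<and> finite (Ar J) \<and> is_functor J C D \<longrightarrow>
        (\<exists>L \<pi>. is_limit J C D L \<pi>))"

text \<open>In the stability clause, \<open>m \<cdot> e\<close> is pulled back along \<open>g\<close> in two steps, which yields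
  \<open>m' \<cdot> e'\<close>.\<close>

definition regular_category :: "('o, 'm) cat \<Rightarrow> bool" where
  "regular_category C \<longleftrightarrow> finitely_complete C \<and>
     (\<forall>f \<in> Ar C. \<exists>e m. regular_epi C e \<and> mono C m \<and> Cod C e = Dom C m \<and> f = m \<cdot>\<^bsub>C\<^esub> e) \<and>
     (\<forall>e m g m' e' q r. regular_epi C e \<and> mono C m \<and> Cod C e = Dom C m \<and>
        is_pullback C m g q m' \<and> is_pullback C e q r e' \<longrightarrow> regular_epi C e' \<and> mono C m')"

definition normal_category :: "('o, 'm) cat \<Rightarrow> bool" where
  "normal_category C \<longleftrightarrow> pointed C \<and> regular_category C \<and>
     (\<forall>f. regular_epi C f \<longrightarrow> normal_epi C f)"


section \<open>Torsion theories\<close>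

text \<open>Full subcategories are given by their sets of objects.\<close>

definition replete :: "('o, 'm) cat \<Rightarrow> 'o set \<Rightarrow> bool" where
  "replete C X \<longleftrightarrow> X \<subseteq> Ob C \<and> (\<forall>A \<in> X. \<forall>B \<in> Ob C. isomorphic C A B \<longrightarrow> B \<in> X)"

definition full_subcat :: "('o, 'm) cat \<Rightarrow> 'o set \<Rightarrow> ('o, 'm) cat" where
  "full_subcat C X = C\<lparr>Ob := X, Ar := {f \<in> Ar C. Dom C f \<in> X \<and> Cod C f \<in> X}\<rparr>"

definition torsion_theory :: "('o, 'm) cat \<Rightarrow> 'o set \<Rightarrow> 'o set \<Rightarrow> bool" where
  "torsion_theory C Y X \<longleftrightarrow> pointed C \<and> replete C Y \<and> replete C X \<and>
     (\<forall>S \<in> Y. \<forall>F \<in> X. \<forall>f \<in> hom C S F. zero_arrow C f) \<and>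
     (\<forall>A \<in> Ob C. \<exists>k f. short_exact C k f \<and> Cod C k = A \<and> Dom C k \<in> Y \<and> Cod C f \<in> X)"

text \<open>In both definitions below \<open>id_ftor\<close> is the inclusion functor of the full subcategory.\<close>

definition reflector :: "('o, 'm) cat \<Rightarrow> 'o set \<Rightarrow> ('o, 'm, 'o, 'm) ftor \<Rightarrow> bool" where
  "reflector C X I \<longleftrightarrow> (\<exists>\<eta> \<epsilon>. adjunction C (full_subcat C X) I id_ftor \<eta> \<epsilon>)"

definition coreflector ::
  "('o, 'm) cat \<Rightarrow> 'o set \<Rightarrow> ('o, 'm, 'o, 'm) ftor \<Rightarrow> ('o \<Rightarrow> 'm) \<Rightarrow> bool"
where
  "coreflector C Y T t \<longleftrightarrow> (\<exists>\<eta>. adjunction (full_subcat C Y) C id_ftor T \<eta> t)"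


section \<open>Factorisation systems\<close>

definition orth :: "('o, 'm) cat \<Rightarrow> 'm \<Rightarrow> 'm \<Rightarrow> bool" where
  "orth C e m \<longleftrightarrow>
     (\<forall>a \<in> hom C (Dom C e) (Dom C m). \<forall>b \<in> hom C (Cod C e) (Cod C m).
        m \<cdot>\<^bsub>C\<^esub> a = b \<cdot>\<^bsub>C\<^esub> e \<longrightarrow>
        (\<exists>!d. d \<in> hom C (Cod C e) (Dom C m) \<and> d \<cdot>\<^bsub>C\<^esub> e = a \<and> m \<cdot>\<^bsub>C\<^esub> d = b))"

definition orth_right :: "('o, 'm) cat \<Rightarrow> 'm set \<Rightarrow> 'm set" where
  "orth_right C \<A> = {m \<in> Ar C. \<forall>e \<in> \<A>. orth C e m}"

definition orth_left :: "('o, 'm) cat \<Rightarrow> 'm set \<Rightarrow> 'm set" where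
  "orth_left C \<A> = {e \<in> Ar C. \<forall>m \<in> \<A>. orth C e m}"

definition factorisation_system :: "('o, 'm) cat \<Rightarrow> 'm set \<Rightarrow> 'm set \<Rightarrow> bool" where
  "factorisation_system C \<A> \<B> \<longleftrightarrow>
     \<A> = orth_left C \<B> \<and> \<B> = orth_right C \<A> \<and>
     (\<forall>f \<in> Ar C. \<exists>e \<in> \<A>. \<exists>m \<in> \<B>. Cod C e = Dom C m \<and> f = m \<cdot>\<^bsub>C\<^esub> e)"

inductive_set pullback_closure :: "('o, 'm) cat \<Rightarrow> 'm set \<Rightarrow> 'm set"
  for C :: "('o, 'm) cat" and \<A> :: "'m set"
where
  base: "f \<in> \<A> \<Longrightarrow> f \<in> pullback_closure C \<A>"
| pull: "f \<in> pullback_closure C \<A> \<Longrightarrow> is_pullback C f g q f' \<Longrightarrow> f' \<in> pullback_closure C \<A>"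

text \<open>For a reflective subcategory \<open>X\<close> of \<open>C\<close> with reflector \<open>I\<close>, the reflective factorisation
  system consists of the classes \<open>refl_E C X I\<close> and \<open>refl_M C X\<close>.\<close>

definition refl_E :: "('o, 'm) cat \<Rightarrow> 'o set \<Rightarrow> ('o, 'm, 'o, 'm) ftor \<Rightarrow> 'm set" where
  "refl_E C X I = {f \<in> Ar C. iso (full_subcat C X) (on_ar I f)}"

definition refl_M :: "('o, 'm) cat \<Rightarrow> 'o set \<Rightarrow> 'm set" where
  "refl_M C X = pullback_closure C (Ar (full_subcat C X))"


section \<open>Effective descent morphisms\<close>

definition slice :: "('o, 'm) cat \<Rightarrow> 'o \<Rightarrow> ('m, 'm \<times> 'm \<times> 'm) cat" where
  "slice C B =
     \<lparr>Ob = {f \<in> Ar C. Cod C f = B},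
      Ar = {(f, h, g). f \<in> Ar C \<and> g \<in> Ar C \<and> Cod C f = B \<and> Cod C g = B \<and>
              h \<in> hom C (Dom C f) (Dom C g) \<and> g \<cdot>\<^bsub>C\<^esub> h = f},
      Dom = (\<lambda>(f, h, g). f),
      Cod = (\<lambda>(f, h, g). g),
      Idt = (\<lambda>f. (f, Idt C (Dom C f), f)),
      Cmp = (\<lambda>(g, k, l) (f, h, g'). (f, k \<cdot>\<^bsub>C\<^esub> h, l))\<rparr>"

text \<open>A chosen pullback \<open>f \<cdot> q = p \<cdot> r\<close> of \<open>f\<close> along \<open>p\<close>, as the pair \<open>(q, r)\<close>. Different
  choices give naturally isomorphic pullback functors, so monadicity does not depend on them.\<close>

definition chosen_pullback :: "('o, 'm) cat \<Rightarrow> 'm \<Rightarrow> 'm \<Rightarrow> 'm \<times> 'm" where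
  "chosen_pullback C p f = (SOME (q, r). is_pullback C f p q r)"

definition pullback_ftor :: "('o, 'm) cat \<Rightarrow> 'm \<Rightarrow> ('m, 'm \<times> 'm \<times> 'm, 'm, 'm \<times> 'm \<times> 'm) ftor" where
  "pullback_ftor C p =
    (let q = (\<lambda>f. fst (chosen_pullback C p f)); r = (\<lambda>f. snd (chosen_pullback C p f))
     in \<lparr>on_ob = r,
         on_ar = (\<lambda>(f, h, g). (r f,
            (THE u. u \<in> hom C (Dom C (r f)) (Dom C (r g)) \<and>
                    q g \<cdot>\<^bsub>C\<^esub> u = h \<cdot>\<^bsub>C\<^esub> q f \<and> r g \<cdot>\<^bsub>C\<^esub> u = r f), r g))\<rparr>)"

definition effective_descent :: "('o, 'm) cat \<Rightarrow> 'm \<Rightarrow> bool" where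
  "effective_descent C p \<longleftrightarrow> p \<in> Ar C \<and>
     monadic (slice C (Cod C p)) (slice C (Dom C p)) (pullback_ftor C p)"

definition descent_projective :: "('o, 'm) cat \<Rightarrow> 'o \<Rightarrow> bool" where
  "descent_projective C P \<longleftrightarrow> P \<in> Ob C \<and>
     (\<forall>p. effective_descent C p \<longrightarrow>
        (\<forall>f \<in> hom C P (Cod C p). \<exists>g \<in> hom C P (Dom C p). p \<cdot>\<^bsub>C\<^esub> g = f))"

definition enough_descent_projectives :: "('o, 'm) cat \<Rightarrow> bool" where
  "enough_descent_projectives C \<longleftrightarrow>
     (\<forall>B \<in> Ob C. \<exists>p. effective_descent C p \<and> Cod C p = B \<and> descent_projective C (Dom C p))"


section \<open>Classes of morphisms\<close>

definition stably_in :: "('o, 'm) cat \<Rightarrow> 'm set \<Rightarrow> 'm set" where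
  "stably_in C \<A> = {f \<in> Ar C. \<forall>g q f'. is_pullback C f g q f' \<longrightarrow> f' \<in> \<A>}"

definition locally_in :: "('o, 'm) cat \<Rightarrow> 'm set \<Rightarrow> 'm set" where
  "locally_in C \<A> =
     {f \<in> Ar C. \<exists>p q f'. effective_descent C p \<and> is_pullback C f p q f' \<and> f' \<in> \<A>}"

definition E_bar :: "('o, 'm) cat \<Rightarrow> 'o set \<Rightarrow> 'm set" where
  "E_bar C Y = {f \<in> Ar C. normal_epi C f \<and> (\<exists>k. is_kernel C k f \<and> Dom C k \<in> Y)}"

definition M_bar :: "('o, 'm) cat \<Rightarrow> 'o set \<Rightarrow> 'm set" where
  "M_bar C X = {f \<in> Ar C. \<exists>k. is_kernel C k f \<and> Dom C k \<in> X}"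

end

theory Submission
  imports Defs
begin

text \<open>Write \<open>E\<close>, \<open>M\<close> for the reflective factorisation system of the torsion-free part \<open>X\<close>. The proof rests
  on two descriptions that replace functors and kernels by conditions on single arrows. By the universal
  property of the unit, \<open>e\<close> is in \<open>E\<close> if and only if every arrow from its domain to an object of \<open>X\<close>
  extends uniquely along \<open>e\<close> (\<open>refl_E_iff\<close>). And \<open>m\<close> is in \<open>M_bar\<close> if and only if an arrow from a
  torsion object vanishes as soon as its composite with \<open>m\<close> does (\<open>M_barD\<close>, \<open>M_barI\<close>). The second
  description shows that \<open>M_bar\<close> is stable under pullback, that membership in it can be tested after
  any pullback, and hence that it contains every arrow that is locally in \<open>M\<close>.

  The hypothesis on normal monomorphisms makes \<open>E_bar\<close>, \<open>M_bar\<close> a factorisation system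
  (\<open>bar_factorisation_system\<close>): the torsion part of the kernel of \<open>f\<close> is a normal subobject of the
  domain of \<open>f\<close>, the quotient by it is in \<open>E_bar\<close>, and what remains of \<open>f\<close> has a torsion-free kernel.
  Since normal epimorphisms are stable under pullback, so is \<open>E_bar\<close>, and as the reflector turns its
  members into isomorphisms, \<open>E_bar\<close> consists of arrows stably in \<open>E\<close>.

  The implications then follow from short arguments.
  If the codomain of an arrow in \<open>M_bar\<close> is covered by an object of \<open>X\<close>, the pulled back arrow lies
  between objects of \<open>X\<close>, because \<open>X\<close> is closed under extensions; so it is in \<open>M\<close>
  (\<open>torsionfree_covers_imp\<close>).
  If \<open>M_bar\<close> is the class of arrows locally in \<open>M\<close> and \<open>f\<close> is stably in \<open>E\<close>, factor \<open>f\<close> through \<open>E_bar\<close> and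
  \<open>M_bar\<close>: a suitable pullback of the second factor is both in \<open>M\<close> and in \<open>E\<close>, hence an
  isomorphism, and pulling back along an effective descent morphism reflects isomorphisms
  (\<open>stably_refl_E_eq_E_bar\<close>). This identifies the two pairs of classes, and the factorisation system
  on the one is that on the other.
  Finally, if \<open>P\<close> is projective, then an arrow into \<open>P\<close> that is locally in \<open>M\<close> is in \<open>M\<close>, as the cover
  splits; applied to \<open>0 \<rightarrow> P\<close> this forces \<open>P\<close> to be torsion-free
  (\<open>descent_projective_torsionfree\<close>), so covers by projective objects are covers by objects of \<open>X\<close>.\<close>


section \<open>Arrows and pullbacks\<close>

context category
begin

lemma in_hom: "f \<in> hom C A B \<longleftrightarrow> f \<in> Ar C \<and> Dom C f = A \<and> Cod C f = B"
  by (simp add: hom_def)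

lemma comp_arrow [simp]:
  assumes "f \<in> Ar C" "g \<in> Ar C" "Dom C g = Cod C f"
  shows "g \<cdot> f \<in> Ar C" "Dom C (g \<cdot> f) = Dom C f" "Cod C (g \<cdot> f) = Cod C g"
  using Cmp_in[of f "Dom C f" "Cod C f" g "Cod C g"] assms by (auto simp: in_hom)

lemma comp_assoc [simp]:
  assumes "f \<in> Ar C" "g \<in> Ar C" "h \<in> Ar C" "Dom C g = Cod C f" "Dom C h = Cod C g"
  shows "(h \<cdot> g) \<cdot> f = h \<cdot> (g \<cdot> f)"
  using Cmp_assoc[of f "Dom C f" "Cod C f" g "Cod C g" h "Cod C h"] assms by (auto simp: in_hom)

lemma identity [simp]:
  assumes "A \<in> Ob C"
  shows "Idt C A \<in> Ar C" "Dom C (Idt C A) = A" "Cod C (Idt C A) = A"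
  using Idt_in[OF assms] by (auto simp: in_hom)

lemma comp_identity [simp]: "f \<in> Ar C \<Longrightarrow> Dom C f = A \<Longrightarrow> f \<cdot> Idt C A = f"
  using Idt_right[of f A "Cod C f"] by (auto simp: in_hom)

lemma identity_comp [simp]: "f \<in> Ar C \<Longrightarrow> Cod C f = A \<Longrightarrow> Idt C A \<cdot> f = f"
  using Idt_left[of f "Dom C f" A] by (auto simp: in_hom)

lemma hom_objects: "f \<in> hom C A B \<Longrightarrow> A \<in> Ob C \<and> B \<in> Ob C"
  using Dom_in Cod_in by (auto simp: in_hom)

lemma dom_cod_object [simp]: "f \<in> Ar C \<Longrightarrow> Dom C f \<in> Ob C" "f \<in> Ar C \<Longrightarrow> Cod C f \<in> Ob C"
  using Dom_in Cod_in by auto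

lemma comp_square:
  assumes "f \<cdot> p = g \<cdot> q" "f \<in> Ar C" "p \<in> Ar C" "g \<in> Ar C" "q \<in> Ar C" "u \<in> Ar C"
    "Dom C f = Cod C p" "Dom C g = Cod C q" "Cod C u = Dom C p" "Dom C q = Dom C p"
  shows "f \<cdot> (p \<cdot> u) = g \<cdot> (q \<cdot> u)"
  using assms by (metis comp_assoc)

lemma comp_triangle:
  assumes "f \<cdot> p = g" "f \<in> Ar C" "p \<in> Ar C" "u \<in> Ar C" "Dom C f = Cod C p" "Cod C u = Dom C p"
  shows "f \<cdot> (p \<cdot> u) = g \<cdot> u"
  using assms by auto

lemma comp_reassoc:
  assumes "f \<in> Ar C" "p \<in> Ar C" "u \<in> Ar C" "Dom C f = Cod C p" "Cod C u = Dom C p"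
  shows "f \<cdot> (p \<cdot> u) = (f \<cdot> p) \<cdot> u"
  using assms by simp

lemma isoI:
  assumes "f \<in> hom C A B" "g \<in> hom C B A" "g \<cdot> f = Idt C A" "f \<cdot> g = Idt C B"
  shows "iso C f"
  using assms unfolding iso_def by (auto simp: in_hom)

lemma isoE:
  assumes "iso C f"
  obtains g where "f \<in> Ar C" "g \<in> Ar C" "Dom C g = Cod C f" "Cod C g = Dom C f"
    "g \<cdot> f = Idt C (Dom C f)" "f \<cdot> g = Idt C (Cod C f)"
  using assms unfolding iso_def by (auto simp: in_hom)

lemma iso_comp:
  assumes "iso C f" "iso C g" "Dom C g = Cod C f"
  shows "iso C (g \<cdot> f)"
proof -
  obtain f' where f': "f \<in> Ar C" "f' \<in> Ar C" "Dom C f' = Cod C f" "Cod C f' = Dom C f"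
    "f' \<cdot> f = Idt C (Dom C f)" "f \<cdot> f' = Idt C (Cod C f)" using assms(1) by (rule isoE)
  obtain g' where g': "g \<in> Ar C" "g' \<in> Ar C" "Dom C g' = Cod C g" "Cod C g' = Dom C g"
    "g' \<cdot> g = Idt C (Dom C g)" "g \<cdot> g' = Idt C (Cod C g)" using assms(2) by (rule isoE)
  have "g' \<cdot> (g \<cdot> f) = f" using f' g' assms(3) comp_reassoc[of g' g f] by simp
  moreover have "f \<cdot> (f' \<cdot> g') = g'" using f' g' assms(3) comp_reassoc[of f f' g'] by simp
  ultimately show ?thesis
    using f' g' assms(3) by (intro isoI[of _ "Dom C f" "Cod C g" "f' \<cdot> g'"]) (auto simp: in_hom)
qed

lemma iso_cancel_left:
  assumes "iso C (g \<cdot> f)" "iso C g" "f \<in> Ar C" "Dom C g = Cod C f"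
  shows "iso C f"
proof -
  obtain g' where g': "g \<in> Ar C" "g' \<in> Ar C" "Dom C g' = Cod C g" "Cod C g' = Dom C g"
    "g' \<cdot> g = Idt C (Dom C g)" "g \<cdot> g' = Idt C (Cod C g)" using assms(2) by (rule isoE)
  have "iso C g'" using g' by (intro isoI[of _ "Cod C g" "Dom C g" g]) (auto simp: in_hom)
  moreover have "g' \<cdot> (g \<cdot> f) = f" using g' assms(3,4) comp_reassoc[of g' g f] by simp
  ultimately show ?thesis using iso_comp[OF assms(1), of g'] g' assms(3,4) by simp
qed

lemma orthD:
  assumes "orth C e m" "a \<in> hom C (Dom C e) (Dom C m)" "b \<in> hom C (Cod C e) (Cod C m)" "m \<cdot> a = b \<cdot> e"
  shows "\<exists>!d. d \<in> hom C (Cod C e) (Dom C m) \<and> d \<cdot> e = a \<and> m \<cdot> d = b"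
  using assms unfolding orth_def by blast

lemma iso_self_orthogonal:
  assumes "f \<in> Ar C" "orth C f f"
  shows "iso C f"
proof -
  have "\<exists>!d. d \<in> hom C (Cod C f) (Dom C f) \<and> d \<cdot> f = Idt C (Dom C f) \<and> f \<cdot> d = Idt C (Cod C f)"
    using assms by (intro orthD) (auto simp: in_hom)
  then show ?thesis using assms(1) unfolding iso_def by blast
qed

lemma pullback_arrows:
  assumes "is_pullback C f g p q"
  shows "f \<in> Ar C" "g \<in> Ar C" "p \<in> Ar C" "q \<in> Ar C" "Cod C g = Cod C f" "Dom C q = Dom C p"
    "Cod C p = Dom C f" "Cod C q = Dom C g" "f \<cdot> p = g \<cdot> q"
  using assms unfolding is_pullback_def by auto

lemma pullback_universal:
  assumes "is_pullback C f g p q" "a \<in> hom C W (Dom C f)" "b \<in> hom C W (Dom C g)" "f \<cdot> a = g \<cdot> b"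
  shows "\<exists>!u. u \<in> hom C W (Dom C p) \<and> p \<cdot> u = a \<and> q \<cdot> u = b"
proof -
  have "\<forall>W. \<forall>a \<in> hom C W (Dom C f). \<forall>b \<in> hom C W (Dom C g). f \<cdot> a = g \<cdot> b \<longrightarrow>
      (\<exists>!u. u \<in> hom C W (Dom C p) \<and> p \<cdot> u = a \<and> q \<cdot> u = b)"
    using assms(1) unfolding is_pullback_def by (elim conjE)
  then show ?thesis using assms(2-4) by simp
qed

lemma pullback_lift:
  assumes "is_pullback C f g p q" "a \<in> Ar C" "b \<in> Ar C" "Cod C a = Dom C f" "Cod C b = Dom C g"
    "Dom C b = Dom C a" "f \<cdot> a = g \<cdot> b"
  obtains u where "u \<in> Ar C" "Dom C u = Dom C a" "Cod C u = Dom C p" "p \<cdot> u = a" "q \<cdot> u = b"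
proof -
  have "a \<in> hom C (Dom C a) (Dom C f)" "b \<in> hom C (Dom C a) (Dom C g)"
    using assms by (auto simp: in_hom)
  then have "\<exists>!u. u \<in> hom C (Dom C a) (Dom C p) \<and> p \<cdot> u = a \<and> q \<cdot> u = b"
    using assms(1,7) pullback_universal by simp
  then show ?thesis using that by (auto simp: in_hom)
qed

lemma pullback_ext:
  assumes pb: "is_pullback C f g p q" and u: "u \<in> Ar C" "Cod C u = Dom C p"
    and v: "v \<in> Ar C" "Cod C v = Dom C p" "Dom C v = Dom C u"
    and eq: "p \<cdot> u = p \<cdot> v" "q \<cdot> u = q \<cdot> v"
  shows "u = v"
proof -
  note P = pullback_arrows[OF pb]
  have "f \<cdot> (p \<cdot> u) = g \<cdot> (q \<cdot> u)" using P u comp_square[of f p g q u] by auto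
  moreover have "p \<cdot> u \<in> hom C (Dom C u) (Dom C f)" "q \<cdot> u \<in> hom C (Dom C u) (Dom C g)"
    using P u by (auto simp: in_hom)
  ultimately have "\<exists>!w. w \<in> hom C (Dom C u) (Dom C p) \<and> p \<cdot> w = p \<cdot> u \<and> q \<cdot> w = q \<cdot> u"
    using pullback_universal[OF pb] by simp
  then show ?thesis using u v eq by (metis in_hom)
qed

lemma pullbackI:
  assumes "f \<in> Ar C" "g \<in> Ar C" "p \<in> Ar C" "q \<in> Ar C" "Cod C g = Cod C f" "Dom C q = Dom C p"
    "Cod C p = Dom C f" "Cod C q = Dom C g" "f \<cdot> p = g \<cdot> q"
    and "\<And>a b. a \<in> Ar C \<Longrightarrow> b \<in> Ar C \<Longrightarrow> Cod C a = Dom C f \<Longrightarrow> Cod C b = Dom C g \<Longrightarrow>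
       Dom C b = Dom C a \<Longrightarrow> f \<cdot> a = g \<cdot> b \<Longrightarrow>
       \<exists>u. u \<in> Ar C \<and> Dom C u = Dom C a \<and> Cod C u = Dom C p \<and> p \<cdot> u = a \<and> q \<cdot> u = b"
    and "\<And>u v. u \<in> Ar C \<Longrightarrow> v \<in> Ar C \<Longrightarrow> Cod C u = Dom C p \<Longrightarrow> Cod C v = Dom C p \<Longrightarrow>
       Dom C u = Dom C v \<Longrightarrow> p \<cdot> u = p \<cdot> v \<Longrightarrow> q \<cdot> u = q \<cdot> v \<Longrightarrow> u = v"
  shows "is_pullback C f g p q"
  unfolding is_pullback_def
proof (intro conjI allI ballI impI)
  fix W a b assume ab: "a \<in> hom C W (Dom C f)" "b \<in> hom C W (Dom C g)" "f \<cdot> a = g \<cdot> b"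
  then obtain u where "u \<in> Ar C \<and> Dom C u = Dom C a \<and> Cod C u = Dom C p \<and> p \<cdot> u = a \<and> q \<cdot> u = b"
    using assms(10)[of a b] by (auto simp: in_hom)
  then show "\<exists>!u. u \<in> hom C W (Dom C p) \<and> p \<cdot> u = a \<and> q \<cdot> u = b"
    using ab assms(11)[of _ u] by (intro ex1I[of _ u]) (auto simp: in_hom)
qed (use assms(1-9) in auto)

lemma identity_pullback:
  assumes "g \<in> Ar C"
  shows "is_pullback C (Idt C (Cod C g)) g g (Idt C (Dom C g))"
proof (rule pullbackI)
  fix a b assume "a \<in> Ar C" "b \<in> Ar C" "Cod C a = Dom C (Idt C (Cod C g))" "Cod C b = Dom C g"
    "Dom C b = Dom C a" "Idt C (Cod C g) \<cdot> a = g \<cdot> b"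
  then show "\<exists>u. u \<in> Ar C \<and> Dom C u = Dom C a \<and> Cod C u = Dom C g \<and> g \<cdot> u = a \<and> Idt C (Dom C g) \<cdot> u = b"
    using assms by (intro exI[of _ b]) auto
qed (use assms in auto)

lemma pullback_of_iso:
  assumes pb: "is_pullback C f g p q" and f: "iso C f"
  shows "iso C q"
proof -
  note P = pullback_arrows[OF pb]
  obtain f' where f': "f' \<in> Ar C" "Dom C f' = Cod C f" "Cod C f' = Dom C f"
    "f' \<cdot> f = Idt C (Dom C f)" "f \<cdot> f' = Idt C (Cod C f)" using f by (rule isoE)
  have "f \<cdot> (f' \<cdot> g) = g \<cdot> Idt C (Dom C g)" using P f' comp_reassoc[of f f' g] by simp
  then obtain s where s: "s \<in> Ar C" "Dom C s = Dom C g" "Cod C s = Dom C p" "p \<cdot> s = f' \<cdot> g"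
      "q \<cdot> s = Idt C (Dom C g)"
    using P f' pullback_lift[OF pb, of "f' \<cdot> g" "Idt C (Dom C g)"] by auto
  have "p \<cdot> (s \<cdot> q) = f' \<cdot> (g \<cdot> q)" using P f' s comp_reassoc[of p s q] by simp
  also have "\<dots> = f' \<cdot> (f \<cdot> p)" using P by simp
  also have "\<dots> = p" using P f' comp_reassoc[of f' f p] by simp
  finally have 1: "p \<cdot> (s \<cdot> q) = p" .
  have "q \<cdot> (s \<cdot> q) = q" using P s comp_reassoc[of q s q] by simp
  then have "s \<cdot> q = Idt C (Dom C q)" using 1 P s by - (rule pullback_ext[OF pb], auto)
  then show ?thesis using P s by (intro isoI[of q "Dom C q" "Dom C g" s]) (auto simp: in_hom)
qed

text \<open>Two pullbacks of the same cospan differ by an isomorphism of their vertices, so any one of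
  them decides whether the pulled back arrow is invertible.\<close>

lemma pullback_iso_transfer:
  assumes pb: "is_pullback C f g p q" and pb': "is_pullback C f g p' q'" and q: "iso C q"
  shows "iso C q'"
proof -
  note P = pullback_arrows[OF pb] and P' = pullback_arrows[OF pb']
  obtain u where u: "u \<in> Ar C" "Dom C u = Dom C p" "Cod C u = Dom C p'" "p' \<cdot> u = p" "q' \<cdot> u = q"
    using P P' pullback_lift[OF pb', of p q] by auto
  obtain v where v: "v \<in> Ar C" "Dom C v = Dom C p'" "Cod C v = Dom C p" "p \<cdot> v = p'" "q \<cdot> v = q'"
    using P P' pullback_lift[OF pb, of p' q'] by auto
  have "p \<cdot> (v \<cdot> u) = p" "q \<cdot> (v \<cdot> u) = q"
    using P P' u v comp_reassoc[of p v u] comp_reassoc[of q v u] by auto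
  then have vu: "v \<cdot> u = Idt C (Dom C p)" using P u v by - (rule pullback_ext[OF pb], auto)
  have "p' \<cdot> (u \<cdot> v) = p'" "q' \<cdot> (u \<cdot> v) = q'"
    using P P' u v comp_reassoc[of p' u v] comp_reassoc[of q' u v] by auto
  then have "u \<cdot> v = Idt C (Dom C p')" using P' u v by - (rule pullback_ext[OF pb'], auto)
  then have "iso C v" using vu u v by (intro isoI[of v "Dom C p'" "Dom C p" u]) (auto simp: in_hom)
  then have "iso C (q \<cdot> v)" using P v q by (intro iso_comp) auto
  then show ?thesis using v by simp
qed

text \<open>The section \<open>s\<close> of \<open>p\<close> and the identity induce an arrow from the domain of \<open>f\<close> into the pullback,
  which exhibits \<open>f\<close> as a pullback of \<open>f'\<close>: pulling back along \<open>p\<close> and then along \<open>s\<close> changes nothing.\<close>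

lemma pullback_along_section:
  assumes pb: "is_pullback C f p q f'" and s: "s \<in> Ar C" "Cod C s = Dom C p"
    "Dom C s = Cod C p" "p \<cdot> s = Idt C (Cod C p)"
  shows "\<exists>r. is_pullback C f' s r f"
proof -
  note P = pullback_arrows[OF pb]
  have "f \<cdot> Idt C (Dom C f) = p \<cdot> (s \<cdot> f)" using P s comp_reassoc[of p s f] by simp
  then obtain r where r: "r \<in> Ar C" "Dom C r = Dom C f" "Cod C r = Dom C q"
      "q \<cdot> r = Idt C (Dom C f)" "f' \<cdot> r = s \<cdot> f"
    using P s pullback_lift[OF pb, of "Idt C (Dom C f)" "s \<cdot> f"] by auto
  have "is_pullback C f' s r f"
  proof (rule pullbackI)
    fix a b assume a: "a \<in> Ar C" "b \<in> Ar C" "Cod C a = Dom C f'" "Cod C b = Dom C s"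
      "Dom C b = Dom C a" and eq: "f' \<cdot> a = s \<cdot> b"
    let ?u = "q \<cdot> a"
    have "f \<cdot> (q \<cdot> a) = p \<cdot> (f' \<cdot> a)" using P a comp_square[of f q p f' a] by auto
    also have "\<dots> = b" using eq P a s comp_reassoc[of p s b] by simp
    finally have fu: "f \<cdot> ?u = b" .
    have "q \<cdot> (r \<cdot> ?u) = q \<cdot> a" using P r a by (simp add: comp_triangle[OF r(4)])
    moreover have "f' \<cdot> (r \<cdot> ?u) = f' \<cdot> a"
      using P r a s fu eq by (simp add: comp_triangle[OF r(5)])
    ultimately have "r \<cdot> ?u = a" using P r a by - (rule pullback_ext[OF pb], auto)
    then show "\<exists>u. u \<in> Ar C \<and> Dom C u = Dom C a \<and> Cod C u = Dom C r \<and> r \<cdot> u = a \<and> f \<cdot> u = b"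
      using P r a fu by (intro exI[of _ ?u]) auto
  next
    fix u v assume u: "u \<in> Ar C" "v \<in> Ar C" "Cod C u = Dom C r" "Cod C v = Dom C r"
      "Dom C u = Dom C v" "r \<cdot> u = r \<cdot> v"
    have "q \<cdot> (r \<cdot> u) = u" "q \<cdot> (r \<cdot> v) = v"
      using P r u(1-5) by (simp_all add: comp_triangle[OF r(4)])
    then show "u = v" using u by metis
  qed (use P r s in auto)
  then show ?thesis ..
qed

lemma pullback_paste_along:
  assumes ef: "e \<in> Ar C" "m \<in> Ar C" "Dom C m = Cod C e"
    and pm: "is_pullback C m g q m'" and pe: "is_pullback C e q r e'"
  shows "is_pullback C (m \<cdot> e) g r (m' \<cdot> e')"
proof -
  note M = pullback_arrows[OF pm] and E = pullback_arrows[OF pe]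
  show ?thesis
  proof (rule pullbackI)
    show "(m \<cdot> e) \<cdot> r = g \<cdot> (m' \<cdot> e')"
      using M E ef comp_square[of m q g m' e'] by simp
  next
    fix a b assume a: "a \<in> Ar C" "b \<in> Ar C" "Cod C a = Dom C (m \<cdot> e)" "Cod C b = Dom C g"
      "Dom C b = Dom C a" and eq: "(m \<cdot> e) \<cdot> a = g \<cdot> b"
    then obtain u where u: "u \<in> Ar C" "Dom C u = Dom C a" "Cod C u = Dom C q" "q \<cdot> u = e \<cdot> a"
        "m' \<cdot> u = b"
      using ef pullback_lift[OF pm, of "e \<cdot> a" b] by auto
    then obtain v where "v \<in> Ar C" "Dom C v = Dom C a" "Cod C v = Dom C r" "r \<cdot> v = a" "e' \<cdot> v = u"
      using a ef M E pullback_lift[OF pe, of a u] by auto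
    then show "\<exists>u. u \<in> Ar C \<and> Dom C u = Dom C a \<and> Cod C u = Dom C r \<and> r \<cdot> u = a \<and> (m' \<cdot> e') \<cdot> u = b"
      using u M E by (intro exI[of _ v]) auto
  next
    fix u v assume u: "u \<in> Ar C" "v \<in> Ar C" "Cod C u = Dom C r" "Cod C v = Dom C r"
      "Dom C u = Dom C v" "r \<cdot> u = r \<cdot> v" "(m' \<cdot> e') \<cdot> u = (m' \<cdot> e') \<cdot> v"
    have "q \<cdot> (e' \<cdot> u) = q \<cdot> (e' \<cdot> v)"
      using u M E comp_square[of e r q e' u] comp_square[of e r q e' v] by metis
    moreover have "m' \<cdot> (e' \<cdot> u) = m' \<cdot> (e' \<cdot> v)" using u M E by simp
    ultimately have "e' \<cdot> u = e' \<cdot> v" using u M E by - (rule pullback_ext[OF pm], auto)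
    then show "u = v" using u E by - (rule pullback_ext[OF pe], auto)
  qed (use M E ef in auto)
qed

lemma pullback_stably_in:
  assumes "f \<in> stably_in C \<A>" "is_pullback C f g q f'"
  shows "f' \<in> \<A>"
  using assms unfolding stably_in_def by blast

text \<open>The right orthogonal of any class is stable under pullback: a diagonal for the original square
  and the given bottom edge together induce the diagonal into the pullback.\<close>

lemma orth_pullback:
  assumes e: "e \<in> Ar C" and o: "orth C e f" and pb: "is_pullback C f g q f'"
  shows "orth C e f'"
  unfolding orth_def
proof (intro ballI impI)
  note P = pullback_arrows[OF pb]
  fix a b assume ab: "a \<in> hom C (Dom C e) (Dom C f')" "b \<in> hom C (Cod C e) (Cod C f')"
    and eq: "f' \<cdot> a = b \<cdot> e"
  note a = ab[unfolded in_hom]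
  have sq: "f \<cdot> (q \<cdot> a) = (g \<cdot> b) \<cdot> e"
    using a e P eq by (simp add: comp_triangle[OF P(9)])
  have "\<exists>!d. d \<in> hom C (Cod C e) (Dom C f) \<and> d \<cdot> e = q \<cdot> a \<and> f \<cdot> d = g \<cdot> b"
    using sq a e P by (intro orthD[OF o]) (auto simp: in_hom)
  then obtain d where dhom: "d \<in> hom C (Cod C e) (Dom C f)" "d \<cdot> e = q \<cdot> a" "f \<cdot> d = g \<cdot> b"
    and uniq: "\<And>d'. d' \<in> hom C (Cod C e) (Dom C f) \<Longrightarrow> d' \<cdot> e = q \<cdot> a \<Longrightarrow> f \<cdot> d' = g \<cdot> b \<Longrightarrow> d' = d"
    by (elim ex1E) blast
  have d: "d \<in> Ar C" "Dom C d = Cod C e" "Cod C d = Dom C f" "d \<cdot> e = q \<cdot> a" "f \<cdot> d = g \<cdot> b"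
    using dhom by (auto simp: in_hom)
  obtain u where u: "u \<in> Ar C" "Dom C u = Cod C e" "Cod C u = Dom C q" "q \<cdot> u = d" "f' \<cdot> u = b"
    using a d P pullback_lift[OF pb, of d b] by auto
  have "q \<cdot> (u \<cdot> e) = q \<cdot> a" "f' \<cdot> (u \<cdot> e) = f' \<cdot> a"
    using u P e eq d by (simp_all add: comp_triangle[OF u(4)] comp_triangle[OF u(5)])
  then have "u \<cdot> e = a" using u P e a by - (rule pullback_ext[OF pb], auto)
  then show "\<exists>!d. d \<in> hom C (Cod C e) (Dom C f') \<and> d \<cdot> e = a \<and> f' \<cdot> d = b"
  proof (intro ex1I[of _ u])
    fix v assume "v \<in> hom C (Cod C e) (Dom C f') \<and> v \<cdot> e = a \<and> f' \<cdot> v = b"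
    then have v: "v \<in> Ar C" "Dom C v = Cod C e" "Cod C v = Dom C q" "v \<cdot> e = a" "f' \<cdot> v = b"
      using P by (auto simp: in_hom)
    have "f \<cdot> (q \<cdot> v) = g \<cdot> b" using v P by (simp add: comp_triangle[OF P(9)])
    then have "q \<cdot> v = d" using v P e by (intro uniq) (auto simp: in_hom)
    then show "v = u" using u v P by - (rule pullback_ext[OF pb], auto)
  qed (use u P in \<open>auto simp: in_hom\<close>)
qed

lemma mono_cancel:
  assumes "mono C m" "u \<in> Ar C" "v \<in> Ar C" "Cod C u = Dom C m" "Cod C v = Dom C m"
    "Dom C v = Dom C u" "m \<cdot> u = m \<cdot> v"
  shows "u = v"
proof -
  have "u \<in> hom C (Dom C u) (Dom C m)" "v \<in> hom C (Dom C u) (Dom C m)"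
    using assms by (auto simp: in_hom)
  then show ?thesis using assms(1,7) unfolding mono_def by blast
qed

lemma regular_epi_arrow: "regular_epi C f \<Longrightarrow> f \<in> Ar C"
  unfolding regular_epi_def is_coequaliser_def by auto

lemma regular_epi_cancel:
  assumes f: "regular_epi C f" and u: "u \<in> Ar C" "v \<in> Ar C" "Dom C u = Cod C f" "Dom C v = Cod C f"
    "Cod C v = Cod C u" and eq: "u \<cdot> f = v \<cdot> f"
  shows "u = v"
proof -
  obtain g h where c: "is_coequaliser C g h f" using f unfolding regular_epi_def by blast
  then have g: "g \<in> Ar C" "h \<in> Ar C" "f \<in> Ar C" "Dom C f = Cod C g" "Cod C g = Cod C h"
      "Dom C g = Dom C h" "f \<cdot> g = f \<cdot> h" unfolding is_coequaliser_def by auto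
  have "(u \<cdot> f) \<cdot> g = (u \<cdot> f) \<cdot> h" using u g by simp
  moreover have "u \<cdot> f \<in> hom C (Dom C f) (Cod C u)" using u g by (auto simp: in_hom)
  ultimately have "\<exists>!w. w \<in> hom C (Cod C f) (Cod C u) \<and> w \<cdot> f = u \<cdot> f"
    using c unfolding is_coequaliser_def by blast
  then show ?thesis using u eq by (metis in_hom)
qed

end


section \<open>Finite completeness yields pullbacks\<close>

text \<open>The shape \<open>0 \<rightarrow> 2 \<leftarrow> 1\<close>: the arrows 0, 1, 2 are the identities, and 3, 4 are the two legs.\<close>

definition cospan_shape :: "(nat, nat) cat" where
  "cospan_shape = \<lparr>Ob = {0, 1, 2}, Ar = {0, 1, 2, 3, 4},
     Dom = (\<lambda>a. if a = 3 then 0 else if a = 4 then 1 else a),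
     Cod = (\<lambda>a. if a = 3 \<or> a = 4 then 2 else a),
     Idt = (\<lambda>x. x),
     Cmp = (\<lambda>b a. if b < 3 then a else b)\<rparr>"

definition cospan_diagram :: "('o, 'm) cat \<Rightarrow> 'm \<Rightarrow> 'm \<Rightarrow> (nat, nat, 'o, 'm) ftor" where
  "cospan_diagram C f g =
    (let ob = (\<lambda>x. if x = 0 then Dom C f else if x = 1 then Dom C g else Cod C f)
     in \<lparr>on_ob = ob, on_ar = (\<lambda>a. if a = 3 then f else if a = 4 then g else Idt C (ob a))\<rparr>)"

lemma cospan_shape_category: "category cospan_shape"
  by unfold_locales (auto simp: cospan_shape_def hom_def split: if_splits)

context category
begin

lemma cospan_diagram_functor:
  assumes "f \<in> Ar C" "g \<in> Ar C" "Cod C f = Cod C g"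
  shows "is_functor cospan_shape C (cospan_diagram C f g)"
  using assms category_axioms cospan_shape_category unfolding is_functor_def
  by (auto simp: cospan_shape_def cospan_diagram_def Let_def hom_def split: if_splits)

lemma pullback_exists:
  assumes fc: "finitely_complete C" and f: "f \<in> Ar C" "g \<in> Ar C" "Cod C f = Cod C g"
  shows "\<exists>p q. is_pullback C f g p q"
proof -
  let ?D = "cospan_diagram C f g"
  have fin: "finite (Ob cospan_shape)" "finite (Ar cospan_shape)" by (auto simp: cospan_shape_def)
  obtain L \<pi> where lim: "is_limit cospan_shape C ?D L \<pi>"
    using fc fin cospan_diagram_functor[OF f] unfolding finitely_complete_def by blast
  have cone_iff: "is_cone cospan_shape C ?D W \<sigma> \<longleftrightarrow> \<sigma> 0 \<in> hom C W (Dom C f) \<and> \<sigma> 1 \<in> hom C W (Dom C g) \<and>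
      \<sigma> 2 = f \<cdot> \<sigma> 0 \<and> f \<cdot> \<sigma> 0 = g \<cdot> \<sigma> 1" for W \<sigma>
    using f unfolding is_cone_def
    by (auto simp: cospan_shape_def cospan_diagram_def hom_def)
  have \<pi>: "\<pi> 0 \<in> hom C L (Dom C f)" "\<pi> 1 \<in> hom C L (Dom C g)" "\<pi> 2 = f \<cdot> \<pi> 0" "f \<cdot> \<pi> 0 = g \<cdot> \<pi> 1"
    using lim unfolding is_limit_def cone_iff by auto
  have "\<exists>!u. u \<in> hom C W L \<and> \<pi> 0 \<cdot> u = a \<and> \<pi> 1 \<cdot> u = b"
    if ab: "a \<in> hom C W (Dom C f)" "b \<in> hom C W (Dom C g)" "f \<cdot> a = g \<cdot> b" for W a b
  proof -
    let ?\<sigma> = "\<lambda>x::nat. if x = 0 then a else if x = 1 then b else f \<cdot> a"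
    have "is_cone cospan_shape C ?D W ?\<sigma>" using ab unfolding cone_iff by simp
    then have "\<exists>!u. u \<in> hom C W L \<and> (\<forall>j \<in> Ob cospan_shape. \<pi> j \<cdot> u = ?\<sigma> j)"
      using lim unfolding is_limit_def by blast
    moreover have "(\<forall>j \<in> Ob cospan_shape. \<pi> j \<cdot> u = ?\<sigma> j) \<longleftrightarrow> \<pi> 0 \<cdot> u = a \<and> \<pi> 1 \<cdot> u = b"
      if "u \<in> hom C W L" for u
      using that \<pi> f comp_assoc[of u "\<pi> 0" f] by (auto simp: cospan_shape_def hom_def)
    ultimately show ?thesis by (metis (no_types, lifting))
  qed
  moreover have "Dom C (\<pi> 0) = L" "Dom C (\<pi> 1) = L" "\<pi> 0 \<in> Ar C" "\<pi> 1 \<in> Ar C"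
    "Cod C (\<pi> 0) = Dom C f" "Cod C (\<pi> 1) = Dom C g" using \<pi> by (simp_all add: in_hom)
  ultimately have "is_pullback C f g (\<pi> 0) (\<pi> 1)"
    using \<pi>(4) f unfolding is_pullback_def by simp
  then show ?thesis by blast
qed

end


section \<open>Zero arrows, kernels and cokernels\<close>

locale pointed_category = category +
  assumes pointed: "pointed C"
begin

definition zero :: "'a \<Rightarrow> 'a \<Rightarrow> 'b" where
  "zero A B = (THE f. f \<in> hom C A B \<and> zero_arrow C f)"

lemma to_zero_unique: "zero_object C Z \<Longrightarrow> f \<in> hom C A Z \<Longrightarrow> g \<in> hom C A Z \<Longrightarrow> f = g"
  using hom_objects[of f A Z] unfolding zero_object_def terminal_def by blast

lemma from_zero_unique: "zero_object C Z \<Longrightarrow> f \<in> hom C Z A \<Longrightarrow> g \<in> hom C Z A \<Longrightarrow> f = g"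
  using hom_objects[of f Z A] unfolding zero_object_def initial_def by blast

lemma zero_object_arrows:
  assumes "zero_object C Z" "A \<in> Ob C"
  obtains u v where "u \<in> hom C A Z" "v \<in> hom C Z A"
  using assms unfolding zero_object_def initial_def terminal_def by blast

lemma zero_arrowI:
  assumes "zero_object C Z" "u \<in> hom C A Z" "v \<in> hom C Z B" "f = v \<cdot> u"
  shows "zero_arrow C f"
proof -
  have "f \<in> hom C A B" using Cmp_in[OF assms(2,3)] assms(4) by simp
  then have f: "f \<in> Ar C" "Dom C f = A" "Cod C f = B" by (simp_all add: in_hom)
  show ?thesis unfolding zero_arrow_def f
    by (intro conjI f(1) exI[of _ Z] bexI[of _ u] bexI[of _ v] assms)
qed

lemma zero_arrowE:
  assumes "zero_arrow C f" "f \<in> hom C A B"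
  obtains Z u v where "zero_object C Z" "u \<in> hom C A Z" "v \<in> hom C Z B" "f = v \<cdot> u"
proof -
  have "Dom C f = A" "Cod C f = B" using assms(2) by (simp_all add: in_hom)
  then have "\<exists>Z. zero_object C Z \<and> (\<exists>u \<in> hom C A Z. \<exists>v \<in> hom C Z B. f = v \<cdot> u)"
    using assms(1) unfolding zero_arrow_def by simp
  then show ?thesis using that by (elim exE conjE bexE)
qed

text \<open>The zero arrow does not depend on the zero object through which it factors, as any two zero
  objects are linked by an arrow compatible with all arrows into and out of them.\<close>

lemma zero_arrow_unique:
  assumes f: "zero_arrow C f" "f \<in> hom C A B" and g: "zero_arrow C g" "g \<in> hom C A B"
  shows "f = g"
proof -
  obtain Z u v where Z: "zero_object C Z" "u \<in> hom C A Z" "v \<in> hom C Z B" "f = v \<cdot> u"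
    using f by (rule zero_arrowE)
  obtain Z' u' v' where Z': "zero_object C Z'" "u' \<in> hom C A Z'" "v' \<in> hom C Z' B" "g = v' \<cdot> u'"
    using g by (rule zero_arrowE)
  obtain w where w: "w \<in> hom C Z Z'"
    using zero_object_arrows[OF Z(1)] Z'(1) unfolding zero_object_def initial_def by metis
  have "w \<cdot> u = u'" by (rule to_zero_unique[OF Z'(1) Cmp_in[OF Z(2) w] Z'(2)])
  moreover have "v' \<cdot> w = v" by (rule from_zero_unique[OF Z(1) Cmp_in[OF w Z'(3)] Z(3)])
  ultimately show ?thesis using Z Z' Cmp_assoc[OF Z(2) w Z'(3)] by simp
qed

lemma zero_eqI:
  assumes "f \<in> hom C A B" "zero_arrow C f"
  shows "zero A B = f"
  unfolding zero_def
proof (rule the_equality)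
  fix g assume "g \<in> hom C A B \<and> zero_arrow C g"
  then show "g = f" using assms by (intro zero_arrow_unique) auto
qed (use assms in simp)

lemma zero_through:
  assumes "zero_object C Z" "u \<in> hom C A Z" "v \<in> hom C Z B"
  shows "v \<cdot> u = zero A B"
proof -
  have "v \<cdot> u \<in> hom C A B" by (rule Cmp_in[OF assms(2,3)])
  moreover have "zero_arrow C (v \<cdot> u)" by (rule zero_arrowI[OF assms refl])
  ultimately show ?thesis using zero_eqI by simp
qed

lemma zero_factors:
  assumes "A \<in> Ob C" "B \<in> Ob C"
  obtains Z u v where "zero_object C Z" "u \<in> hom C A Z" "v \<in> hom C Z B" "zero A B = v \<cdot> u"
proof -
  obtain Z where Z: "zero_object C Z" using pointed unfolding pointed_def by blast
  obtain u where u: "u \<in> hom C A Z" using Z assms(1) by (rule zero_object_arrows)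
  obtain v where v: "v \<in> hom C Z B" using Z assms(2) by (rule zero_object_arrows)
  show ?thesis using that[OF Z u v] zero_through[OF Z u v] by simp
qed

lemma zero_hom: "A \<in> Ob C \<Longrightarrow> B \<in> Ob C \<Longrightarrow> zero A B \<in> hom C A B"
  by (erule (1) zero_factors) (simp add: Cmp_in)

lemma zero_arr [simp]:
  assumes "A \<in> Ob C" "B \<in> Ob C"
  shows "zero A B \<in> Ar C" "Dom C (zero A B) = A" "Cod C (zero A B) = B"
  using zero_hom[OF assms] by (auto simp: in_hom)

lemma zero_arrow_iff: "f \<in> hom C A B \<Longrightarrow> zero_arrow C f \<longleftrightarrow> f = zero A B"
proof
  assume f: "f \<in> hom C A B" and eq: "f = zero A B"
  have "A \<in> Ob C" "B \<in> Ob C" using hom_objects[OF f] by auto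
  then show "zero_arrow C f" unfolding eq by (rule zero_factors) (rule zero_arrowI)
qed (metis zero_eqI)

lemma comp_zero [simp]:
  assumes "A \<in> Ob C" "g \<in> Ar C" "Dom C g = B"
  shows "g \<cdot> zero A B = zero A (Cod C g)"
proof -
  have "B \<in> Ob C" using assms by auto
  with assms(1) obtain Z u v where Z: "zero_object C Z" "u \<in> hom C A Z" "v \<in> hom C Z B" "zero A B = v \<cdot> u"
    by (rule zero_factors)
  have g: "g \<in> hom C B (Cod C g)" using assms by (simp add: in_hom)
  have "g \<cdot> zero A B = (g \<cdot> v) \<cdot> u" using Z Cmp_assoc[OF Z(2,3) g] by simp
  then show ?thesis using zero_through[OF Z(1,2) Cmp_in[OF Z(3) g]] by simp
qed

lemma zero_comp [simp]:
  assumes "D \<in> Ob C" "f \<in> Ar C" "Cod C f = B"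
  shows "zero B D \<cdot> f = zero (Dom C f) D"
proof -
  have "B \<in> Ob C" using assms by auto
  from this assms(1) obtain Z u v where Z: "zero_object C Z" "u \<in> hom C B Z" "v \<in> hom C Z D" "zero B D = v \<cdot> u"
    by (rule zero_factors)
  have f: "f \<in> hom C (Dom C f) B" using assms by (simp add: in_hom)
  have "zero B D \<cdot> f = v \<cdot> (u \<cdot> f)" using Z Cmp_assoc[OF f Z(2,3)] by simp
  then show ?thesis using zero_through[OF Z(1) Cmp_in[OF f Z(2)] Z(3)] by simp
qed

text \<open>The universal properties of kernels and cokernels in terms of zero arrows alone, which avoids
  carrying a zero object through the arguments.\<close>

lemma is_kernel_iff:
  "is_kernel C k f \<longleftrightarrow> k \<in> Ar C \<and> f \<in> Ar C \<and> Cod C k = Dom C f \<and>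
     f \<cdot> k = zero (Dom C k) (Cod C f) \<and>
     (\<forall>W. \<forall>a \<in> hom C W (Dom C f). f \<cdot> a = zero W (Cod C f) \<longrightarrow>
        (\<exists>!u. u \<in> hom C W (Dom C k) \<and> k \<cdot> u = a))" (is "_ \<longleftrightarrow> ?R")
proof
  assume "is_kernel C k f"
  then obtain z t where Z: "zero_object C (Dom C z)" and pb: "is_pullback C f z k t"
    unfolding is_kernel_def by blast
  note P = pullback_arrows[OF pb]
  have fk: "f \<cdot> k = zero (Dom C k) (Cod C f)"
    unfolding P(9) by (rule zero_through[OF Z]) (use P in \<open>auto simp: in_hom\<close>)
  have "\<exists>!u. u \<in> hom C W (Dom C k) \<and> k \<cdot> u = a"
    if a: "a \<in> hom C W (Dom C f)" "f \<cdot> a = zero W (Cod C f)" for W a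
  proof -
    have "W \<in> Ob C" using a(1) hom_objects by blast
    with Z obtain w where w: "w \<in> hom C W (Dom C z)" by (rule zero_object_arrows)
    have "z \<cdot> w = zero W (Cod C f)"
      by (rule zero_through[OF Z w]) (use P in \<open>auto simp: in_hom\<close>)
    then have "\<exists>!u. u \<in> hom C W (Dom C k) \<and> k \<cdot> u = a \<and> t \<cdot> u = w"
      using a w by (intro pullback_universal[OF pb]) auto
    moreover have "t \<cdot> u = w" if "u \<in> hom C W (Dom C k)" for u
      using to_zero_unique[OF Z] Cmp_in[OF that] w P by (auto simp: in_hom)
    ultimately show ?thesis by (metis (no_types, lifting))
  qed
  then show ?R using P fk by blast
next
  assume R: ?R
  obtain Z where Z: "zero_object C Z" using pointed unfolding pointed_def by blast
  have "Cod C f \<in> Ob C" "Dom C k \<in> Ob C" using R by auto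
  then obtain z t where z: "z \<in> hom C Z (Cod C f)" and t: "t \<in> hom C (Dom C k) Z"
    using zero_object_arrows[OF Z] by metis
  have "is_pullback C f z k t"
  proof (rule pullbackI)
    show "f \<cdot> k = z \<cdot> t" using R zero_through[OF Z t z] by simp
  next
    fix a b assume a: "a \<in> Ar C" "b \<in> Ar C" "Cod C a = Dom C f" "Cod C b = Dom C z"
      "Dom C b = Dom C a" "f \<cdot> a = z \<cdot> b"
    have "z \<cdot> b = zero (Dom C a) (Cod C f)"
      by (rule zero_through[OF Z _ z]) (use a z in \<open>auto simp: in_hom\<close>)
    then have "\<exists>!u. u \<in> hom C (Dom C a) (Dom C k) \<and> k \<cdot> u = a" using R a by (auto simp: in_hom)
    then obtain u where u: "u \<in> hom C (Dom C a) (Dom C k)" "k \<cdot> u = a" by blast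
    moreover have "t \<cdot> u = b" using to_zero_unique[OF Z Cmp_in[OF u(1) t]] a z by (auto simp: in_hom)
    ultimately show "\<exists>u. u \<in> Ar C \<and> Dom C u = Dom C a \<and> Cod C u = Dom C k \<and> k \<cdot> u = a \<and> t \<cdot> u = b"
      by (auto simp: in_hom)
  next
    fix u v assume u: "u \<in> Ar C" "v \<in> Ar C" "Cod C u = Dom C k" "Cod C v = Dom C k"
      "Dom C u = Dom C v" "k \<cdot> u = k \<cdot> v"
    have "f \<cdot> (k \<cdot> u) = zero (Dom C u) (Cod C f)"
      using R u by (simp add: comp_triangle[of f k "zero (Dom C k) (Cod C f)"])
    then have "\<exists>!w. w \<in> hom C (Dom C u) (Dom C k) \<and> k \<cdot> w = k \<cdot> u" using R u(1,3) by (simp add: in_hom)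
    moreover have "u \<in> hom C (Dom C u) (Dom C k)" "v \<in> hom C (Dom C u) (Dom C k)"
      using u(1-5) by (simp_all add: in_hom)
    ultimately show "u = v" using u(6) by metis
  qed (use R z t in \<open>auto simp: in_hom\<close>)
  then show "is_kernel C k f" unfolding is_kernel_def using Z z by (auto simp: in_hom)
qed

lemma kernelE:
  assumes "is_kernel C k f"
  shows "k \<in> Ar C" "f \<in> Ar C" "Cod C k = Dom C f" "f \<cdot> k = zero (Dom C k) (Cod C f)"
  using assms unfolding is_kernel_iff by auto

lemma kernel_lift:
  assumes "is_kernel C k f" "a \<in> Ar C" "Cod C a = Dom C f" "f \<cdot> a = zero (Dom C a) (Cod C f)"
  obtains u where "u \<in> Ar C" "Dom C u = Dom C a" "Cod C u = Dom C k" "k \<cdot> u = a"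
proof -
  have "a \<in> hom C (Dom C a) (Dom C f)" using assms by (simp add: in_hom)
  then have "\<exists>!u. u \<in> hom C (Dom C a) (Dom C k) \<and> k \<cdot> u = a" using assms unfolding is_kernel_iff by blast
  then show ?thesis using that by (auto simp: in_hom)
qed

lemma kernel_cancel:
  assumes k: "is_kernel C k f" and u: "u \<in> Ar C" "v \<in> Ar C" "Cod C u = Dom C k" "Cod C v = Dom C k"
    "Dom C v = Dom C u" and eq: "k \<cdot> u = k \<cdot> v"
  shows "u = v"
proof -
  note K = kernelE[OF k]
  have "f \<cdot> (k \<cdot> u) = zero (Dom C u) (Cod C f)" using K u by (simp add: comp_triangle[OF K(4)])
  moreover have "k \<cdot> u \<in> hom C (Dom C u) (Dom C f)" using K u by (simp add: in_hom)
  ultimately have "\<exists>!w. w \<in> hom C (Dom C u) (Dom C k) \<and> k \<cdot> w = k \<cdot> u"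
    using k unfolding is_kernel_iff by blast
  moreover have "u \<in> hom C (Dom C u) (Dom C k)" "v \<in> hom C (Dom C u) (Dom C k)"
    using u by (simp_all add: in_hom)
  ultimately show "u = v" using eq by metis
qed

lemma kernelI:
  assumes "k \<in> Ar C" "f \<in> Ar C" "Cod C k = Dom C f" "f \<cdot> k = zero (Dom C k) (Cod C f)"
    and lift: "\<And>a. a \<in> Ar C \<Longrightarrow> Cod C a = Dom C f \<Longrightarrow> f \<cdot> a = zero (Dom C a) (Cod C f) \<Longrightarrow>
       \<exists>u. u \<in> Ar C \<and> Dom C u = Dom C a \<and> Cod C u = Dom C k \<and> k \<cdot> u = a"
    and cancel: "\<And>u v. u \<in> Ar C \<Longrightarrow> v \<in> Ar C \<Longrightarrow> Cod C u = Dom C k \<Longrightarrow> Cod C v = Dom C k \<Longrightarrow>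
       Dom C v = Dom C u \<Longrightarrow> k \<cdot> u = k \<cdot> v \<Longrightarrow> u = v"
  shows "is_kernel C k f"
  unfolding is_kernel_iff
proof (intro conjI allI ballI impI)
  fix W a assume a: "a \<in> hom C W (Dom C f)" "f \<cdot> a = zero W (Cod C f)"
  then obtain u where u: "u \<in> hom C W (Dom C k)" "k \<cdot> u = a"
    using lift[of a] by (auto simp: in_hom)
  moreover have "v = u" if "v \<in> hom C W (Dom C k)" "k \<cdot> v = a" for v
    using cancel[of v u] that u by (simp add: in_hom)
  ultimately show "\<exists>!u. u \<in> hom C W (Dom C k) \<and> k \<cdot> u = a" by blast
qed (use assms(1-4) in auto)

lemma is_cokernel_iff:
  "is_cokernel C f k \<longleftrightarrow> f \<in> Ar C \<and> k \<in> Ar C \<and> Dom C f = Cod C k \<and>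
     f \<cdot> k = zero (Dom C k) (Cod C f) \<and>
     (\<forall>W. \<forall>a \<in> hom C (Cod C k) W. a \<cdot> k = zero (Dom C k) W \<longrightarrow>
        (\<exists>!u. u \<in> hom C (Cod C f) W \<and> u \<cdot> f = a))" (is "_ \<longleftrightarrow> ?R")
proof
  assume "is_cokernel C f k"
  then obtain z t where Z: "zero_object C (Cod C t)" and po: "is_pushout C k t f z"
    unfolding is_cokernel_def by blast
  have P: "k \<in> Ar C" "t \<in> Ar C" "f \<in> Ar C" "z \<in> Ar C" "Dom C t = Dom C k" "Cod C z = Cod C f"
    "Dom C f = Cod C k" "Dom C z = Cod C t" "f \<cdot> k = z \<cdot> t"
    using po unfolding is_pushout_def by auto
  have U: "\<forall>W. \<forall>a \<in> hom C (Cod C k) W. \<forall>b \<in> hom C (Cod C t) W. a \<cdot> k = b \<cdot> t \<longrightarrow>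
      (\<exists>!u. u \<in> hom C (Cod C f) W \<and> u \<cdot> f = a \<and> u \<cdot> z = b)"
    using po unfolding is_pushout_def by (elim conjE)
  have fk: "f \<cdot> k = zero (Dom C k) (Cod C f)"
    unfolding P(9) by (rule zero_through[OF Z]) (use P in \<open>auto simp: in_hom\<close>)
  have "\<exists>!u. u \<in> hom C (Cod C f) W \<and> u \<cdot> f = a"
    if a: "a \<in> hom C (Cod C k) W" "a \<cdot> k = zero (Dom C k) W" for W a
  proof -
    have "W \<in> Ob C" using a(1) hom_objects by blast
    with Z obtain w where w: "w \<in> hom C (Cod C t) W" by (rule zero_object_arrows)
    have "w \<cdot> t = zero (Dom C k) W"
      by (rule zero_through[OF Z _ w]) (use P in \<open>auto simp: in_hom\<close>)
    then have "\<exists>!u. u \<in> hom C (Cod C f) W \<and> u \<cdot> f = a \<and> u \<cdot> z = w"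
      using a w U by simp
    moreover have "u \<cdot> z = w" if "u \<in> hom C (Cod C f) W" for u
      using from_zero_unique[OF Z] Cmp_in[OF _ that] w P by (auto simp: in_hom)
    ultimately show ?thesis by (metis (no_types, lifting))
  qed
  then show ?R using P fk by blast
next
  assume R: ?R
  obtain Z where Z: "zero_object C Z" using pointed unfolding pointed_def by blast
  have "Cod C f \<in> Ob C" "Dom C k \<in> Ob C" using R by auto
  then obtain z t where z: "z \<in> hom C Z (Cod C f)" and t: "t \<in> hom C (Dom C k) Z"
    using zero_object_arrows[OF Z] by metis
  have "\<exists>!u. u \<in> hom C (Cod C f) W \<and> u \<cdot> f = a \<and> u \<cdot> z = b"
    if a: "a \<in> hom C (Cod C k) W" and b: "b \<in> hom C Z W" and eq: "a \<cdot> k = b \<cdot> t" for W a b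
  proof -
    have "a \<cdot> k = zero (Dom C k) W" unfolding eq by (rule zero_through[OF Z t b])
    then have "\<exists>!u. u \<in> hom C (Cod C f) W \<and> u \<cdot> f = a" using R a by simp
    moreover have "u \<cdot> z = b" if "u \<in> hom C (Cod C f) W" for u
      using from_zero_unique[OF Z Cmp_in[OF z that] b] .
    ultimately show ?thesis by (metis (no_types, lifting))
  qed
  then have "\<forall>W. \<forall>a \<in> hom C (Cod C k) W. \<forall>b \<in> hom C Z W. a \<cdot> k = b \<cdot> t \<longrightarrow>
      (\<exists>!u. u \<in> hom C (Cod C f) W \<and> u \<cdot> f = a \<and> u \<cdot> z = b)" by simp
  moreover have "Cod C t = Z" "t \<in> Ar C" "Dom C t = Dom C k" "z \<in> Ar C" "Dom C z = Z" "Cod C z = Cod C f"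
    using z t by (simp_all add: in_hom)
  ultimately have "is_pushout C k t f z"
    unfolding is_pushout_def using R zero_through[OF Z t z] by simp
  then show "is_cokernel C f k" unfolding is_cokernel_def using Z t by (auto simp: in_hom)
qed

lemma cokernelE:
  assumes "is_cokernel C f k"
  shows "k \<in> Ar C" "f \<in> Ar C" "Cod C k = Dom C f" "f \<cdot> k = zero (Dom C k) (Cod C f)"
  using assms unfolding is_cokernel_iff by auto

lemma cokernel_universal:
  assumes "is_cokernel C f k" "a \<in> hom C (Dom C f) W" "a \<cdot> k = zero (Dom C k) W"
  shows "\<exists>!u. u \<in> hom C (Cod C f) W \<and> u \<cdot> f = a"
  using assms unfolding is_cokernel_iff by simp

lemma normal_epi_regular_epi:
  assumes "normal_epi C f"
  shows "regular_epi C f"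
proof -
  obtain k where k: "is_cokernel C f k" using assms unfolding normal_epi_def by blast
  note K = cokernelE[OF k]
  have "\<exists>!u. u \<in> hom C (Cod C f) W \<and> u \<cdot> f = a"
    if "a \<in> hom C (Dom C f) W" "a \<cdot> k = a \<cdot> zero (Dom C k) (Dom C f)" for a W
    using that K hom_objects[OF that(1)] by (intro cokernel_universal[OF k]) (auto simp: in_hom)
  then have "is_coequaliser C k (zero (Dom C k) (Dom C f)) f"
    unfolding is_coequaliser_def using K by simp
  then show ?thesis unfolding regular_epi_def by blast
qed

text \<open>An arrow that \<open>f\<close> is the cokernel of factors through the kernel of \<open>f\<close>, so killing the
  kernel is enough.\<close>

lemma normal_epi_factor:
  assumes f: "normal_epi C f" and k: "is_kernel C k f"
    and a: "a \<in> Ar C" "Dom C a = Dom C f" "a \<cdot> k = zero (Dom C k) (Cod C a)"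
  obtains u where "u \<in> Ar C" "Dom C u = Cod C f" "Cod C u = Cod C a" "u \<cdot> f = a"
proof -
  obtain l where l: "is_cokernel C f l" using f unfolding normal_epi_def by blast
  note L = cokernelE[OF l] and K = kernelE[OF k]
  obtain w where w: "w \<in> Ar C" "Dom C w = Dom C l" "Cod C w = Dom C k" "k \<cdot> w = l"
    using kernel_lift[OF k, of l] L by auto
  have "a \<cdot> (k \<cdot> w) = zero (Dom C l) (Cod C a)"
    using w(1-3) K a by (simp add: comp_triangle[OF a(3)])
  then have "a \<cdot> l = zero (Dom C l) (Cod C a)" using w(4) by simp
  then have "\<exists>!u. u \<in> hom C (Cod C f) (Cod C a) \<and> u \<cdot> f = a"
    using a by (intro cokernel_universal[OF l]) (auto simp: in_hom)
  then show ?thesis using that by (auto simp: in_hom)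
qed

lemma kernel_of_pullback:
  assumes pb: "is_pullback C f g q f'" and k: "is_kernel C k f"
  obtains k' where "is_kernel C k' f'" "Dom C k' = Dom C k" "q \<cdot> k' = k"
proof -
  note P = pullback_arrows[OF pb] and K = kernelE[OF k]
  obtain k' where k': "k' \<in> Ar C" "Dom C k' = Dom C k" "Cod C k' = Dom C q" "q \<cdot> k' = k"
      "f' \<cdot> k' = zero (Dom C k) (Dom C g)"
    using pullback_lift[OF pb, of k "zero (Dom C k) (Dom C g)"] P K by auto
  have "is_kernel C k' f'"
  proof (rule kernelI)
    fix a assume a: "a \<in> Ar C" "Cod C a = Dom C f'" "f' \<cdot> a = zero (Dom C a) (Cod C f')"
    have "f \<cdot> (q \<cdot> a) = g \<cdot> (f' \<cdot> a)" using P a by (simp add: comp_triangle[OF P(9)])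
    also have "\<dots> = zero (Dom C a) (Cod C f)" using a P by simp
    finally obtain u where u: "u \<in> Ar C" "Dom C u = Dom C a" "Cod C u = Dom C k" "k \<cdot> u = q \<cdot> a"
      using kernel_lift[OF k, of "q \<cdot> a"] P a by auto
    have "q \<cdot> (k' \<cdot> u) = q \<cdot> a" using u k' P by (simp add: comp_triangle[OF k'(4)])
    moreover have "f' \<cdot> (k' \<cdot> u) = f' \<cdot> a" using u k' P K a by (simp add: comp_triangle[OF k'(5)])
    ultimately have "k' \<cdot> u = a" using P u k' a by - (rule pullback_ext[OF pb], auto)
    then show "\<exists>u. u \<in> Ar C \<and> Dom C u = Dom C a \<and> Cod C u = Dom C k' \<and> k' \<cdot> u = a"
      using u k' by (intro exI[of _ u]) simp
  next
    fix u v assume u: "u \<in> Ar C" "v \<in> Ar C" "Cod C u = Dom C k'" "Cod C v = Dom C k'"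
      "Dom C v = Dom C u" "k' \<cdot> u = k' \<cdot> v"
    have "q \<cdot> (k' \<cdot> u) = q \<cdot> (k' \<cdot> v)" using u(6) by simp
    then have "k \<cdot> u = k \<cdot> v" using u(1-5) k' P by (simp add: comp_triangle[OF k'(4)])
    then show "u = v" using u k' by - (rule kernel_cancel[OF k], auto)
  qed (use k' P K in auto)
  then show ?thesis using that k' by blast
qed

end


section \<open>Normal categories\<close>

locale normal_cat = category +
  assumes normal: "normal_category C"

sublocale normal_cat \<subseteq> pointed_category
  by unfold_locales (use normal in \<open>simp add: normal_category_def\<close>)

context normal_cat
begin

lemma finite_limits: "finitely_complete C"
  using normal unfolding normal_category_def regular_category_def by blast

lemma regular_epi_iff_normal_epi: "regular_epi C f \<longleftrightarrow> normal_epi C f"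
  using normal normal_epi_regular_epi unfolding normal_category_def by blast

lemma image_factorisation:
  assumes "f \<in> Ar C"
  obtains e m where "regular_epi C e" "mono C m" "Cod C e = Dom C m" "f = m \<cdot> e"
  using assms normal unfolding normal_category_def regular_category_def by metis

lemma regular_epi_pullback:
  assumes "regular_epi C f" and pb: "is_pullback C f g q f'"
  shows "regular_epi C f'"
proof -
  note P = pullback_arrows[OF pb]
  have m: "mono C (Idt C (Cod C g))" using P unfolding mono_def by (auto simp: in_hom)
  have stable: "\<forall>e m g m' e' q r. regular_epi C e \<and> mono C m \<and> Cod C e = Dom C m \<and>
        is_pullback C m g q m' \<and> is_pullback C e q r e' \<longrightarrow> regular_epi C e' \<and> mono C m'"
    using normal unfolding normal_category_def regular_category_def by blast
  show ?thesis
    using stable[rule_format, of f "Idt C (Cod C g)" g g "Idt C (Dom C g)" q f']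
      assms m identity_pullback[of g] P by simp
qed

lemma kernel_exists:
  assumes "f \<in> Ar C"
  obtains k where "is_kernel C k f"
proof -
  obtain Z where Z: "zero_object C Z" using pointed unfolding pointed_def by blast
  obtain z where z: "z \<in> hom C Z (Cod C f)" using zero_object_arrows[OF Z] assms by (metis Cod_in)
  then obtain k t where "is_pullback C f z k t"
    using pullback_exists[OF finite_limits assms, of z] by (auto simp: in_hom)
  then show ?thesis using that Z z unfolding is_kernel_def by (auto simp: in_hom)
qed

text \<open>In the image factorisation of \<open>g\<close> the monomorphism does not affect the kernel, so a kernel
  is always the kernel of a regular epimorphism.\<close>

lemma kernel_of_regular_epi:
  assumes k: "is_kernel C k g"
  obtains q where "regular_epi C q" "is_kernel C k q"
proof -
  note K = kernelE[OF k]
  obtain q m where q: "regular_epi C q" "mono C m" "Cod C q = Dom C m" "g = m \<cdot> q"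
    using K(2) by (rule image_factorisation)
  have ar: "q \<in> Ar C" "m \<in> Ar C" using q unfolding mono_def by (auto dest: regular_epi_arrow)
  have g: "Dom C g = Dom C q" "Cod C g = Cod C m" using q(3,4) ar by simp_all
  have "is_kernel C k q"
  proof (rule kernelI)
    have "m \<cdot> (q \<cdot> k) = m \<cdot> zero (Dom C k) (Cod C q)" using K q(3,4) ar g by simp
    then show "q \<cdot> k = zero (Dom C k) (Cod C q)"
      using K q(3) ar g by - (rule mono_cancel[OF q(2)], auto)
  next
    fix a assume a: "a \<in> Ar C" "Cod C a = Dom C q" "q \<cdot> a = zero (Dom C a) (Cod C q)"
    then have "g \<cdot> a = zero (Dom C a) (Cod C g)" using q(3,4) ar by simp
    then obtain u where "u \<in> Ar C" "Dom C u = Dom C a" "Cod C u = Dom C k" "k \<cdot> u = a"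
      using a g kernel_lift[OF k, of a] by auto
    then show "\<exists>u. u \<in> Ar C \<and> Dom C u = Dom C a \<and> Cod C u = Dom C k \<and> k \<cdot> u = a" by blast
  next
    fix u v assume "u \<in> Ar C" "v \<in> Ar C" "Cod C u = Dom C k" "Cod C v = Dom C k"
       "Dom C v = Dom C u" "k \<cdot> u = k \<cdot> v"
    then show "u = v" by (rule kernel_cancel[OF k])
  qed (use K ar g in auto)
  then show ?thesis using that q(1) by blast
qed

end


section \<open>Adjunctions and monadic functors\<close>

lemma functor_hom: "is_functor A B F \<Longrightarrow> f \<in> hom A x y \<Longrightarrow> on_ar F f \<in> hom B (on_ob F x) (on_ob F y)"
  unfolding is_functor_def by blast

lemma functor_ob: "is_functor A B F \<Longrightarrow> x \<in> Ob A \<Longrightarrow> on_ob F x \<in> Ob B"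
  unfolding is_functor_def by blast

lemma functor_id: "is_functor A B F \<Longrightarrow> x \<in> Ob A \<Longrightarrow> on_ar F (Idt A x) = Idt B (on_ob F x)"
  unfolding is_functor_def by blast

lemma functor_comp:
  "is_functor A B F \<Longrightarrow> f \<in> hom A x y \<Longrightarrow> g \<in> hom A y z \<Longrightarrow>
     on_ar F (g \<cdot>\<^bsub>A\<^esub> f) = on_ar F g \<cdot>\<^bsub>B\<^esub> on_ar F f"
  unfolding is_functor_def by blast

lemma nat_trans_hom: "nat_trans A B F G \<tau> \<Longrightarrow> x \<in> Ob A \<Longrightarrow> \<tau> x \<in> hom B (on_ob F x) (on_ob G x)"
  unfolding nat_trans_def by blast

lemma nat_trans_square:
  "nat_trans A B F G \<tau> \<Longrightarrow> f \<in> hom A x y \<Longrightarrow> \<tau> y \<cdot>\<^bsub>B\<^esub> on_ar F f = on_ar G f \<cdot>\<^bsub>B\<^esub> \<tau> x"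
  unfolding nat_trans_def by blast

lemma functor_categories: "is_functor A B F \<Longrightarrow> category A \<and> category B"
  unfolding is_functor_def by blast

lemma id_ftor_simps [simp]: "on_ob id_ftor x = x" "on_ar id_ftor f = f"
  by (simp_all add: id_ftor_def)

lemma comp_ftor_simps [simp]:
  "on_ob (comp_ftor G F) x = on_ob G (on_ob F x)" "on_ar (comp_ftor G F) f = on_ar G (on_ar F f)"
  by (simp_all add: comp_ftor_def)

lemma functor_iso:
  assumes F: "is_functor A B F" and f: "iso A f"
  shows "iso B (on_ar F f)"
proof -
  interpret A: category A using functor_categories[OF F] by blast
  interpret B: category B using functor_categories[OF F] by blast
  obtain g where g: "f \<in> hom A (Dom A f) (Cod A f)" "g \<in> hom A (Cod A f) (Dom A f)"
    "g \<cdot>\<^bsub>A\<^esub> f = Idt A (Dom A f)" "f \<cdot>\<^bsub>A\<^esub> g = Idt A (Cod A f)"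
    using f by (rule A.isoE) (auto simp: A.in_hom)
  have ob: "Dom A f \<in> Ob A" "Cod A f \<in> Ob A" using A.hom_objects[OF g(1)] by auto
  show ?thesis
  proof (rule B.isoI[OF functor_hom[OF F g(1)] functor_hom[OF F g(2)]])
    show "on_ar F g \<cdot>\<^bsub>B\<^esub> on_ar F f = Idt B (on_ob F (Dom A f))"
      using functor_comp[OF F g(1,2)] functor_id[OF F ob(1)] g(3) by simp
    show "on_ar F f \<cdot>\<^bsub>B\<^esub> on_ar F g = Idt B (on_ob F (Cod A f))"
      using functor_comp[OF F g(2,1)] functor_id[OF F ob(2)] g(4) by simp
  qed
qed

lemma adjunction_unit_universal:
  assumes adj: "adjunction A B F G \<eta> \<epsilon>" and x: "x \<in> Ob A" and y: "y \<in> Ob B"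
    and a: "a \<in> hom A x (on_ob G y)"
  shows "\<exists>!u. u \<in> hom B (on_ob F x) y \<and> on_ar G u \<cdot>\<^bsub>A\<^esub> \<eta> x = a"
proof -
  have F: "is_functor A B F" and G: "is_functor B A G"
    and \<eta>: "nat_trans A A id_ftor (comp_ftor G F) \<eta>" and \<epsilon>: "nat_trans B B (comp_ftor F G) id_ftor \<epsilon>"
    and tri1: "\<epsilon> (on_ob F x) \<cdot>\<^bsub>B\<^esub> on_ar F (\<eta> x) = Idt B (on_ob F x)"
    and tri2: "on_ar G (\<epsilon> y) \<cdot>\<^bsub>A\<^esub> \<eta> (on_ob G y) = Idt A (on_ob G y)"
    using adj x y unfolding adjunction_def by auto
  interpret A: category A using functor_categories[OF F] by blast
  interpret B: category B using functor_categories[OF F] by blast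
  have Fa: "on_ar F a \<in> hom B (on_ob F x) (on_ob F (on_ob G y))" by (rule functor_hom[OF F a])
  have \<epsilon>y: "\<epsilon> y \<in> hom B (on_ob F (on_ob G y)) y" using nat_trans_hom[OF \<epsilon> y] by simp
  have \<eta>x: "\<eta> x \<in> hom A x (on_ob G (on_ob F x))" using nat_trans_hom[OF \<eta> x] by simp
  have \<eta>Gy: "\<eta> (on_ob G y) \<in> hom A (on_ob G y) (on_ob G (on_ob F (on_ob G y)))"
    using nat_trans_hom[OF \<eta> functor_ob[OF G y]] by simp
  have \<epsilon>Fx: "\<epsilon> (on_ob F x) \<in> hom B (on_ob F (on_ob G (on_ob F x))) (on_ob F x)"
    using nat_trans_hom[OF \<epsilon> functor_ob[OF F x]] by simp
  let ?u = "\<epsilon> y \<cdot>\<^bsub>B\<^esub> on_ar F a"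
  show ?thesis
  proof (rule ex1I[of _ ?u])
    have "on_ar G ?u \<cdot>\<^bsub>A\<^esub> \<eta> x = on_ar G (\<epsilon> y) \<cdot>\<^bsub>A\<^esub> (on_ar G (on_ar F a) \<cdot>\<^bsub>A\<^esub> \<eta> x)"
      using functor_comp[OF G Fa \<epsilon>y] A.Cmp_assoc[OF \<eta>x functor_hom[OF G Fa] functor_hom[OF G \<epsilon>y]] by simp
    also have "\<dots> = on_ar G (\<epsilon> y) \<cdot>\<^bsub>A\<^esub> (\<eta> (on_ob G y) \<cdot>\<^bsub>A\<^esub> a)"
      using nat_trans_square[OF \<eta> a] by simp
    also have "\<dots> = a" using A.Cmp_assoc[OF a \<eta>Gy functor_hom[OF G \<epsilon>y]] tri2 A.Idt_left[OF a] by simp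
    finally show "?u \<in> hom B (on_ob F x) y \<and> on_ar G ?u \<cdot>\<^bsub>A\<^esub> \<eta> x = a" using B.Cmp_in[OF Fa \<epsilon>y] by simp
  next
    fix u assume "u \<in> hom B (on_ob F x) y \<and> on_ar G u \<cdot>\<^bsub>A\<^esub> \<eta> x = a"
    then have u: "u \<in> hom B (on_ob F x) y" and eq: "on_ar G u \<cdot>\<^bsub>A\<^esub> \<eta> x = a" by auto
    have Gu: "on_ar G u \<in> hom A (on_ob G (on_ob F x)) (on_ob G y)" by (rule functor_hom[OF G u])
    have "?u = \<epsilon> y \<cdot>\<^bsub>B\<^esub> (on_ar F (on_ar G u) \<cdot>\<^bsub>B\<^esub> on_ar F (\<eta> x))"
      using functor_comp[OF F \<eta>x Gu] eq by simp
    also have "\<dots> = (u \<cdot>\<^bsub>B\<^esub> \<epsilon> (on_ob F x)) \<cdot>\<^bsub>B\<^esub> on_ar F (\<eta> x)"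
      using B.Cmp_assoc[OF functor_hom[OF F \<eta>x] functor_hom[OF F Gu] \<epsilon>y] nat_trans_square[OF \<epsilon> u] by simp
    also have "\<dots> = u"
      using B.Cmp_assoc[OF functor_hom[OF F \<eta>x] \<epsilon>Fx u] tri1 B.Idt_right[OF u] by simp
    finally show "u = ?u" by simp
  qed
qed

lemma adjunction_counit_universal:
  assumes adj: "adjunction A B F G \<eta> \<epsilon>" and x: "x \<in> Ob A" and y: "y \<in> Ob B"
    and b: "b \<in> hom B (on_ob F x) y"
  shows "\<exists>!u. u \<in> hom A x (on_ob G y) \<and> \<epsilon> y \<cdot>\<^bsub>B\<^esub> on_ar F u = b"
proof -
  have F: "is_functor A B F" and G: "is_functor B A G"
    and \<eta>: "nat_trans A A id_ftor (comp_ftor G F) \<eta>" and \<epsilon>: "nat_trans B B (comp_ftor F G) id_ftor \<epsilon>"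
    and tri1: "\<epsilon> (on_ob F x) \<cdot>\<^bsub>B\<^esub> on_ar F (\<eta> x) = Idt B (on_ob F x)"
    and tri2: "on_ar G (\<epsilon> y) \<cdot>\<^bsub>A\<^esub> \<eta> (on_ob G y) = Idt A (on_ob G y)"
    using adj x y unfolding adjunction_def by auto
  interpret A: category A using functor_categories[OF F] by blast
  interpret B: category B using functor_categories[OF F] by blast
  have Gb: "on_ar G b \<in> hom A (on_ob G (on_ob F x)) (on_ob G y)" by (rule functor_hom[OF G b])
  have \<epsilon>y: "\<epsilon> y \<in> hom B (on_ob F (on_ob G y)) y" using nat_trans_hom[OF \<epsilon> y] by simp
  have \<eta>x: "\<eta> x \<in> hom A x (on_ob G (on_ob F x))" using nat_trans_hom[OF \<eta> x] by simp
  have \<eta>Gy: "\<eta> (on_ob G y) \<in> hom A (on_ob G y) (on_ob G (on_ob F (on_ob G y)))"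
    using nat_trans_hom[OF \<eta> functor_ob[OF G y]] by simp
  have \<epsilon>Fx: "\<epsilon> (on_ob F x) \<in> hom B (on_ob F (on_ob G (on_ob F x))) (on_ob F x)"
    using nat_trans_hom[OF \<epsilon> functor_ob[OF F x]] by simp
  let ?u = "on_ar G b \<cdot>\<^bsub>A\<^esub> \<eta> x"
  show ?thesis
  proof (rule ex1I[of _ ?u])
    have "\<epsilon> y \<cdot>\<^bsub>B\<^esub> on_ar F ?u = (\<epsilon> y \<cdot>\<^bsub>B\<^esub> on_ar F (on_ar G b)) \<cdot>\<^bsub>B\<^esub> on_ar F (\<eta> x)"
      using functor_comp[OF F \<eta>x Gb] B.Cmp_assoc[OF functor_hom[OF F \<eta>x] functor_hom[OF F Gb] \<epsilon>y] by simp
    also have "\<dots> = (b \<cdot>\<^bsub>B\<^esub> \<epsilon> (on_ob F x)) \<cdot>\<^bsub>B\<^esub> on_ar F (\<eta> x)"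
      using nat_trans_square[OF \<epsilon> b] by simp
    also have "\<dots> = b"
      using B.Cmp_assoc[OF functor_hom[OF F \<eta>x] \<epsilon>Fx b] tri1 B.Idt_right[OF b] by simp
    finally show "?u \<in> hom A x (on_ob G y) \<and> \<epsilon> y \<cdot>\<^bsub>B\<^esub> on_ar F ?u = b" using A.Cmp_in[OF \<eta>x Gb] by simp
  next
    fix u assume "u \<in> hom A x (on_ob G y) \<and> \<epsilon> y \<cdot>\<^bsub>B\<^esub> on_ar F u = b"
    then have u: "u \<in> hom A x (on_ob G y)" and eq: "\<epsilon> y \<cdot>\<^bsub>B\<^esub> on_ar F u = b" by auto
    have Fu: "on_ar F u \<in> hom B (on_ob F x) (on_ob F (on_ob G y))" by (rule functor_hom[OF F u])
    have "?u = on_ar G (\<epsilon> y) \<cdot>\<^bsub>A\<^esub> (on_ar G (on_ar F u) \<cdot>\<^bsub>A\<^esub> \<eta> x)"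
      using functor_comp[OF G Fu \<epsilon>y] eq A.Cmp_assoc[OF \<eta>x functor_hom[OF G Fu] functor_hom[OF G \<epsilon>y]] by simp
    also have "\<dots> = on_ar G (\<epsilon> y) \<cdot>\<^bsub>A\<^esub> (\<eta> (on_ob G y) \<cdot>\<^bsub>A\<^esub> u)"
      using nat_trans_square[OF \<eta> u] by simp
    also have "\<dots> = u" using A.Cmp_assoc[OF u \<eta>Gy functor_hom[OF G \<epsilon>y]] tri2 A.Idt_left[OF u] by simp
    finally show "u = ?u" by simp
  qed
qed

lemma equivalence_reflects_iso:
  assumes K: "equivalence A B K" and f: "f \<in> Ar A" and iso: "iso B (on_ar K f)"
  shows "iso A f"
proof -
  obtain G \<alpha> where G: "is_functor B A G" and \<alpha>: "nat_trans A A id_ftor (comp_ftor G K) \<alpha>"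
    and \<alpha>iso: "\<And>x. x \<in> Ob A \<Longrightarrow> iso A (\<alpha> x)" and KF: "is_functor A B K"
    using K unfolding equivalence_def nat_iso_def by blast
  interpret A: category A using functor_categories[OF KF] by blast
  have ff: "f \<in> hom A (Dom A f) (Cod A f)" using f by (simp add: A.in_hom)
  have GKf: "on_ar G (on_ar K f) \<in> hom A (on_ob G (on_ob K (Dom A f))) (on_ob G (on_ob K (Cod A f)))"
    by (rule functor_hom[OF G functor_hom[OF KF ff]])
  have \<alpha>h: "\<alpha> x \<in> hom A x (on_ob G (on_ob K x))" if "x \<in> Ob A" for x
    using nat_trans_hom[OF \<alpha> that] by simp
  have "\<alpha> (Cod A f) \<cdot>\<^bsub>A\<^esub> f = on_ar G (on_ar K f) \<cdot>\<^bsub>A\<^esub> \<alpha> (Dom A f)"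
    using nat_trans_square[OF \<alpha> ff] by simp
  moreover have "iso A (on_ar G (on_ar K f) \<cdot>\<^bsub>A\<^esub> \<alpha> (Dom A f))"
    using functor_iso[OF G iso] \<alpha>iso[of "Dom A f"] \<alpha>h[of "Dom A f"] GKf f
    by (intro A.iso_comp) (auto simp: A.in_hom)
  ultimately show ?thesis
    using \<alpha>iso[of "Cod A f"] \<alpha>h[of "Cod A f"] f
    by (intro A.iso_cancel_left[of "\<alpha> (Cod A f)" f]) (auto simp: A.in_hom)
qed

text \<open>The forgetful functor from algebras reflects isomorphisms: the inverse of an algebra morphism,
  if it exists downstairs, is automatically an algebra morphism.\<close>

lemma em_cat_iso:
  assumes T: "is_functor A A T" and f: "((x, a), h, (y, b)) \<in> Ar (em_cat A T \<eta> \<mu>)" and h: "iso A h"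
  shows "iso (em_cat A T \<eta> \<mu>) ((x, a), h, (y, b))"
proof -
  interpret A: category A using functor_categories[OF T] by blast
  have algs: "(x, a) \<in> Ob (em_cat A T \<eta> \<mu>)" "(y, b) \<in> Ob (em_cat A T \<eta> \<mu>)" and hh: "h \<in> hom A x y"
    and sq: "h \<cdot>\<^bsub>A\<^esub> a = b \<cdot>\<^bsub>A\<^esub> on_ar T h" and a: "a \<in> hom A (on_ob T x) x" and b: "b \<in> hom A (on_ob T y) y"
    using f by (auto simp: em_cat_def Let_def)
  have ob: "x \<in> Ob A" "y \<in> Ob A" using A.hom_objects[OF hh] by auto
  obtain j where j: "j \<in> hom A y x" "j \<cdot>\<^bsub>A\<^esub> h = Idt A x" "h \<cdot>\<^bsub>A\<^esub> j = Idt A y"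
    using h hh by (elim A.isoE) (auto simp: A.in_hom)
  have Th: "on_ar T h \<in> hom A (on_ob T x) (on_ob T y)" and Tj: "on_ar T j \<in> hom A (on_ob T y) (on_ob T x)"
    by (rule functor_hom[OF T hh], rule functor_hom[OF T j(1)])
  have hj: "on_ar T h \<cdot>\<^bsub>A\<^esub> on_ar T j = Idt A (on_ob T y)"
    using functor_comp[OF T j(1) hh] functor_id[OF T ob(2)] j(3) by simp
  have "b = (h \<cdot>\<^bsub>A\<^esub> a) \<cdot>\<^bsub>A\<^esub> on_ar T j"
    using A.Cmp_assoc[OF Tj Th b] hj A.Idt_right[OF b] sq by simp
  then have "j \<cdot>\<^bsub>A\<^esub> b = (j \<cdot>\<^bsub>A\<^esub> h) \<cdot>\<^bsub>A\<^esub> (a \<cdot>\<^bsub>A\<^esub> on_ar T j)"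
    using A.Cmp_assoc[OF Tj a hh] A.Cmp_assoc[OF A.Cmp_in[OF Tj a] hh j(1)] by simp
  also have "\<dots> = a \<cdot>\<^bsub>A\<^esub> on_ar T j" using j(2) A.Idt_left[OF A.Cmp_in[OF Tj a]] by simp
  finally have "((y, b), j, (x, a)) \<in> Ar (em_cat A T \<eta> \<mu>)"
    using algs j(1) by (simp add: em_cat_def Let_def)
  then show ?thesis
    using f j(2,3) unfolding iso_def by (auto simp: em_cat_def Let_def hom_def intro!: bexI[of _ "((y, b), j, (x, a))"])
qed

text \<open>The comparison functor is an equivalence, and following it by the forgetful functor gives \<open>G\<close>;
  both reflect isomorphisms.\<close>

lemma monadic_reflects_iso:
  assumes G: "monadic B A G" and f: "f \<in> Ar B" and iso: "iso A (on_ar G f)"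
  shows "iso B f"
proof -
  obtain F \<eta> \<epsilon> where adj: "adjunction A B F G \<eta> \<epsilon>"
    and K: "equivalence B (em_cat A (comp_ftor G F) \<eta> (\<lambda>x. on_ar G (\<epsilon> (on_ob F x)))) (comparison B G \<epsilon>)"
      (is "equivalence B ?EM ?K")
    using G unfolding monadic_def by blast
  have T: "is_functor A A (comp_ftor G F)" using adj unfolding adjunction_def nat_trans_def by blast
  have KF: "is_functor B ?EM ?K" using K unfolding equivalence_def by blast
  interpret B: category B using functor_categories[OF KF] by blast
  have "on_ar ?K f \<in> Ar ?EM"
    using functor_hom[OF KF, of f "Dom B f" "Cod B f"] f by (simp add: hom_def)
  then have "iso ?EM (on_ar ?K f)"
    using em_cat_iso[OF T _ iso] by (simp add: comparison_def Let_def)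
  then show ?thesis by (rule equivalence_reflects_iso[OF K f])
qed

context category
begin

lemma slice_iso_iff:
  assumes "(f, h, g) \<in> Ar (slice C B)"
  shows "iso (slice C B) (f, h, g) \<longleftrightarrow> iso C h"
proof -
  have ar: "f \<in> Ar C" "g \<in> Ar C" "Cod C f = B" "Cod C g = B" "h \<in> Ar C" "Dom C h = Dom C f"
      "Cod C h = Dom C g" "g \<cdot> h = f"
    using assms by (auto simp: slice_def in_hom)
  show ?thesis
  proof
    assume "iso (slice C B) (f, h, g)"
    then obtain k' where k': "k' \<in> hom (slice C B) g f" "k' \<cdot>\<^bsub>slice C B\<^esub> (f, h, g) = Idt (slice C B) f"
        "(f, h, g) \<cdot>\<^bsub>slice C B\<^esub> k' = Idt (slice C B) g"
      unfolding iso_def by (elim conjE bexE) (simp add: slice_def)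
    obtain g' k f' where "k' = (g', k, f')" by (cases k')
    then have "k \<in> hom C (Dom C g) (Dom C f)" "k \<cdot> h = Idt C (Dom C f)" "h \<cdot> k = Idt C (Dom C g)"
      using k' by (simp_all add: slice_def hom_def)
    then show "iso C h" using ar by (intro isoI[of h "Dom C f" "Dom C g" k]) (auto simp: in_hom)
  next
    assume "iso C h"
    then obtain k where "k \<in> Ar C" "Dom C k = Cod C h" "Cod C k = Dom C h"
        "k \<cdot> h = Idt C (Dom C h)" "h \<cdot> k = Idt C (Cod C h)"
      by (rule isoE)
    then have k: "k \<in> Ar C" "Dom C k = Dom C g" "Cod C k = Dom C f"
        "k \<cdot> h = Idt C (Dom C f)" "h \<cdot> k = Idt C (Dom C g)"
      unfolding ar(6,7) .
    have "g = g \<cdot> (h \<cdot> k)" using k ar by simp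
    also have "\<dots> = f \<cdot> k" using k(1-3) ar by (simp add: comp_triangle[OF ar(8)])
    finally have "f \<cdot> k = g" by simp
    then show "iso (slice C B) (f, h, g)"
      unfolding iso_def
      by (intro conjI bexI[of _ "(g, k, f)"]) (use ar k in \<open>simp_all add: slice_def hom_def\<close>)
  qed
qed

lemma chosen_pullback:
  assumes "finitely_complete C" "f \<in> Ar C" "p \<in> Ar C" "Cod C f = Cod C p"
  shows "is_pullback C f p (fst (chosen_pullback C p f)) (snd (chosen_pullback C p f))"
proof -
  have "\<exists>x. case x of (q, r) \<Rightarrow> is_pullback C f p q r" using pullback_exists[OF assms] by simp
  then have "case chosen_pullback C p f of (q, r) \<Rightarrow> is_pullback C f p q r"
    unfolding chosen_pullback_def by (rule someI_ex)
  then show ?thesis by (simp add: case_prod_beta)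
qed

text \<open>Conservativity of the pullback functor, freed from the choice of pullbacks. An
  arrow \<open>m\<close> is viewed as an arrow of the slice from \<open>m\<close> to the identity; its image under the pullback
  functor is an isomorphism as soon as one pullback of \<open>m\<close> along \<open>p\<close> is.\<close>

lemma effective_descent_reflects_iso:
  assumes fc: "finitely_complete C" and p: "effective_descent C p"
    and pb: "is_pullback C m p q m'" and iso: "iso C m'"
  shows "iso C m"
proof -
  note P = pullback_arrows[OF pb]
  define q0 r0 where "q0 = fst (chosen_pullback C p m)" and "r0 = snd (chosen_pullback C p m)"
  define q1 r1 where "q1 = fst (chosen_pullback C p (Idt C (Cod C p)))"
    and "r1 = snd (chosen_pullback C p (Idt C (Cod C p)))"
  have pb0: "is_pullback C m p q0 r0" unfolding q0_def r0_def using P fc by (intro chosen_pullback) auto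
  have pb1: "is_pullback C (Idt C (Cod C p)) p q1 r1"
    unfolding q1_def r1_def using P fc by (intro chosen_pullback) auto
  note P0 = pullback_arrows[OF pb0]
  have P1: "q1 \<in> Ar C" "r1 \<in> Ar C" "Dom C r1 = Dom C q1" "Cod C q1 = Cod C p" "Cod C r1 = Dom C p"
    using pullback_arrows(3,4,6,7,8)[OF pb1] P(2) by simp_all
  have r0: "iso C r0" by (rule pullback_iso_transfer[OF pb pb0 iso])
  have "iso C (Idt C (Cod C p))"
    using P by (intro isoI[of _ "Cod C p" "Cod C p" "Idt C (Cod C p)"]) (auto simp: in_hom)
  then have r1: "iso C r1" by (rule pullback_of_iso[OF pb1])
  let ?U = "\<lambda>u. u \<in> hom C (Dom C r0) (Dom C r1) \<and> q1 \<cdot> u = m \<cdot> q0 \<and> r1 \<cdot> u = r0"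
  define u where "u = (THE u. ?U u)"
  have "\<exists>!u. u \<in> hom C (Dom C r0) (Dom C q1) \<and> q1 \<cdot> u = m \<cdot> q0 \<and> r1 \<cdot> u = r0"
    using P P0 P1 by (intro pullback_universal[OF pb1]) (auto simp: in_hom)
  then have "\<exists>!u. ?U u" using P1 by simp
  then have "?U u" unfolding u_def by (rule theI')
  then have u: "u \<in> Ar C" "Dom C u = Dom C r0" "Cod C u = Dom C r1" "r1 \<cdot> u = r0" by (auto simp: in_hom)
  have "iso C u" using r0 r1 u by (intro iso_cancel_left[of r1 u]) auto
  moreover have "(r0, u, r1) \<in> Ar (slice C (Dom C p))"
    using u P0 P1 by (auto simp: slice_def in_hom)
  moreover have "on_ar (pullback_ftor C p) (m, m, Idt C (Cod C p)) = (r0, u, r1)"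
    by (simp add: pullback_ftor_def Let_def u_def q0_def r0_def q1_def r1_def)
  ultimately have "iso (slice C (Dom C p)) (on_ar (pullback_ftor C p) (m, m, Idt C (Cod C p)))"
    by (simp add: slice_iso_iff)
  moreover have m: "(m, m, Idt C (Cod C p)) \<in> Ar (slice C (Cod C p))"
    using P by (auto simp: slice_def in_hom)
  moreover have "monadic (slice C (Cod C p)) (slice C (Dom C p)) (pullback_ftor C p)"
    using p unfolding effective_descent_def by simp
  ultimately have "iso (slice C (Cod C p)) (m, m, Idt C (Cod C p))"
    by - (rule monadic_reflects_iso)
  then show ?thesis using slice_iso_iff[OF m] by simp
qed

end


section \<open>The reflective factorisation system\<close>

locale reflection = category +
  fixes X I
  assumes subcat: "X \<subseteq> Ob C" and reflector: "reflector C X I"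
begin

text \<open>By the universal property of the unit, these are the arrows inverted by the reflector; the
  definition gives access to them without the functor.\<close>

definition X_local :: "'b \<Rightarrow> bool" where
  "X_local f \<longleftrightarrow> f \<in> Ar C \<and>
     (\<forall>F \<in> X. \<forall>a \<in> hom C (Dom C f) F. \<exists>!u. u \<in> hom C (Cod C f) F \<and> u \<cdot> f = a)"

lemma X_localE:
  assumes "X_local f" "a \<in> Ar C" "Dom C a = Dom C f" "Cod C a \<in> X"
  obtains u where "u \<in> Ar C" "Dom C u = Cod C f" "Cod C u = Cod C a" "u \<cdot> f = a"
proof -
  have "a \<in> hom C (Dom C f) (Cod C a)" using assms by (simp add: in_hom)
  then have "\<exists>!u. u \<in> hom C (Cod C f) (Cod C a) \<and> u \<cdot> f = a" using assms unfolding X_local_def by blast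
  then show ?thesis using that by (auto simp: in_hom)
qed

lemma X_local_cancel:
  assumes f: "X_local f" and u: "u \<in> Ar C" "v \<in> Ar C" "Dom C u = Cod C f" "Dom C v = Cod C f"
    "Cod C u = Cod C v" "Cod C v \<in> X" and eq: "u \<cdot> f = v \<cdot> f"
  shows "u = v"
proof -
  have "f \<in> Ar C" using f unfolding X_local_def by simp
  then have "u \<cdot> f \<in> hom C (Dom C f) (Cod C v)" using u by (simp add: in_hom)
  then have "\<exists>!w. w \<in> hom C (Cod C f) (Cod C v) \<and> w \<cdot> f = u \<cdot> f" using f u unfolding X_local_def by blast
  moreover have "u \<in> hom C (Cod C f) (Cod C v)" "v \<in> hom C (Cod C f) (Cod C v)" using u by (simp_all add: in_hom)
  ultimately show ?thesis using eq by metis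
qed

lemma X_localI:
  assumes "f \<in> Ar C"
    and ex: "\<And>a. a \<in> Ar C \<Longrightarrow> Dom C a = Dom C f \<Longrightarrow> Cod C a \<in> X \<Longrightarrow>
      \<exists>u. u \<in> Ar C \<and> Dom C u = Cod C f \<and> Cod C u = Cod C a \<and> u \<cdot> f = a"
    and cancel: "\<And>u v. u \<in> Ar C \<Longrightarrow> v \<in> Ar C \<Longrightarrow> Dom C u = Cod C f \<Longrightarrow> Dom C v = Cod C f \<Longrightarrow>
      Cod C u = Cod C v \<Longrightarrow> Cod C v \<in> X \<Longrightarrow> u \<cdot> f = v \<cdot> f \<Longrightarrow> u = v"
  shows "X_local f"
  unfolding X_local_def
proof (intro conjI ballI)
  fix F a assume F: "F \<in> X" and a: "a \<in> hom C (Dom C f) F"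
  then obtain u where u: "u \<in> hom C (Cod C f) F" "u \<cdot> f = a" using ex[of a] by (auto simp: in_hom)
  moreover have "v = u" if "v \<in> hom C (Cod C f) F" "v \<cdot> f = a" for v
    using cancel[of v u] that u F by (simp add: in_hom)
  ultimately show "\<exists>!u. u \<in> hom C (Cod C f) F \<and> u \<cdot> f = a" by blast
qed (rule assms(1))

lemma hom_full_subcat: "A \<in> X \<Longrightarrow> B \<in> X \<Longrightarrow> hom (full_subcat C X) A B = hom C A B"
  by (auto simp: full_subcat_def hom_def)

lemma full_subcat_simps [simp]:
  "Ob (full_subcat C X) = X" "Cmp (full_subcat C X) = Cmp C" "Idt (full_subcat C X) = Idt C"
  "Dom (full_subcat C X) = Dom C" "Cod (full_subcat C X) = Cod C"
  by (simp_all add: full_subcat_def)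

lemma iso_full_subcat:
  assumes "A \<in> X" "B \<in> X" "f \<in> hom C A B"
  shows "iso (full_subcat C X) f \<longleftrightarrow> iso C f"
proof -
  have "f \<in> Ar (full_subcat C X)" "f \<in> Ar C" "Dom C f = A" "Cod C f = B"
    using assms by (auto simp: full_subcat_def in_hom)
  then show ?thesis using assms unfolding iso_def by (simp add: hom_full_subcat)
qed

text \<open>Composition with the units identifies arrows \<open>I A \<rightarrow> F\<close> with arrows \<open>A \<rightarrow> F\<close>, for \<open>F\<close> in \<open>X\<close>, and turns
  composition with \<open>I f\<close> into composition with \<open>f\<close>. So \<open>f\<close> is \<open>X\<close>-local exactly when \<open>I f\<close> is, and by
  the Yoneda argument the latter means that \<open>I f\<close> is invertible.\<close>

lemma refl_E_iff: "f \<in> refl_E C X I \<longleftrightarrow> X_local f"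
proof (cases "f \<in> Ar C")
  case False
  then show ?thesis unfolding refl_E_def X_local_def by simp
next
  case f: True
  obtain \<eta> \<epsilon> where adj: "adjunction C (full_subcat C X) I id_ftor \<eta> \<epsilon>"
    using reflector unfolding reflector_def by blast
  have If: "is_functor C (full_subcat C X) I" and \<eta>: "nat_trans C C id_ftor (comp_ftor id_ftor I) \<eta>"
    using adj unfolding adjunction_def by auto
  define A B where "A = Dom C f" and "B = Cod C f"
  have ff: "f \<in> hom C A B" using f by (simp add: in_hom A_def B_def)
  have ob: "A \<in> Ob C" "B \<in> Ob C" using hom_objects[OF ff] by auto
  have X: "on_ob I A \<in> X" "on_ob I B \<in> X" using functor_ob[OF If] ob by auto
  have \<eta>A: "\<eta> A \<in> hom C A (on_ob I A)" and \<eta>B: "\<eta> B \<in> hom C B (on_ob I B)"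
    using nat_trans_hom[OF \<eta>] ob by auto
  have Iff: "on_ar I f \<in> hom C (on_ob I A) (on_ob I B)"
    using functor_hom[OF If ff] X by (simp add: hom_full_subcat)
  have sq: "\<eta> B \<cdot> f = on_ar I f \<cdot> \<eta> A" using nat_trans_square[OF \<eta> ff] by simp
  have unit: "\<exists>!u. u \<in> hom C (on_ob I D) F \<and> u \<cdot> \<eta> D = a" if "D \<in> Ob C" "F \<in> X" "a \<in> hom C D F" for D F a
    using adjunction_unit_universal[OF adj that(1), of F a] that functor_ob[OF If that(1)]
    by (simp add: hom_full_subcat)
  note arr = \<eta>A[unfolded in_hom] \<eta>B[unfolded in_hom] Iff[unfolded in_hom] ff[unfolded in_hom]
  have "iso C (on_ar I f) \<longleftrightarrow> X_local f"
  proof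
    assume "iso C (on_ar I f)"
    then obtain h where "h \<in> Ar C" "Dom C h = Cod C (on_ar I f)" "Cod C h = Dom C (on_ar I f)"
      "h \<cdot> on_ar I f = Idt C (Dom C (on_ar I f))" "on_ar I f \<cdot> h = Idt C (Cod C (on_ar I f))"
      by (rule isoE)
    then have h: "h \<in> Ar C" "Dom C h = on_ob I B" "Cod C h = on_ob I A"
      "h \<cdot> on_ar I f = Idt C (on_ob I A)" "on_ar I f \<cdot> h = Idt C (on_ob I B)"
      using arr by simp_all
    show "X_local f"
    proof (rule X_localI)
      fix a assume a: "a \<in> Ar C" "Dom C a = Dom C f" "Cod C a \<in> X"
      then obtain a' where a': "a' \<in> hom C (on_ob I A) (Cod C a)" "a' \<cdot> \<eta> A = a"
        using unit[OF ob(1), of "Cod C a" a] arr by (auto simp: in_hom)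
      note a'' = a'(1)[unfolded in_hom]
      let ?u = "a' \<cdot> (h \<cdot> \<eta> B)"
      have "?u \<cdot> f = a' \<cdot> (h \<cdot> (on_ar I f \<cdot> \<eta> A))" using a'' h(1-3) arr sq by simp
      also have "\<dots> = a" using a'' a'(2) h(1-3) arr by (simp add: comp_triangle[OF h(4)])
      finally show "\<exists>u. u \<in> Ar C \<and> Dom C u = Cod C f \<and> Cod C u = Cod C a \<and> u \<cdot> f = a"
        using a'' h(1-3) arr by (intro exI[of _ ?u]) simp
    next
      fix u v assume u: "u \<in> Ar C" "v \<in> Ar C" "Dom C u = Cod C f" "Dom C v = Cod C f"
        "Cod C u = Cod C v" "Cod C v \<in> X" and eq: "u \<cdot> f = v \<cdot> f"
      obtain u' where u': "u' \<in> hom C (on_ob I B) (Cod C v)" "u' \<cdot> \<eta> B = u"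
        using unit[OF ob(2) u(6), of u] u arr by (auto simp: in_hom)
      obtain v' where v': "v' \<in> hom C (on_ob I B) (Cod C v)" "v' \<cdot> \<eta> B = v"
        using unit[OF ob(2) u(6), of v] u arr by (auto simp: in_hom)
      note u'' = u'(1)[unfolded in_hom] and v'' = v'(1)[unfolded in_hom]
      have "(u' \<cdot> on_ar I f) \<cdot> \<eta> A = u' \<cdot> (\<eta> B \<cdot> f)" using u'' arr sq by simp
      also have "\<dots> = v' \<cdot> (\<eta> B \<cdot> f)"
        using u'' v'' arr eq by (simp add: comp_triangle[OF u'(2)] comp_triangle[OF v'(2)])
      also have "\<dots> = (v' \<cdot> on_ar I f) \<cdot> \<eta> A" using v'' arr sq by simp
      finally have "(u' \<cdot> on_ar I f) \<cdot> \<eta> A = (v' \<cdot> on_ar I f) \<cdot> \<eta> A" .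
      moreover have "u' \<cdot> on_ar I f \<in> hom C (on_ob I A) (Cod C v)" "v' \<cdot> on_ar I f \<in> hom C (on_ob I A) (Cod C v)"
        by (rule Cmp_in[OF Iff u'(1)], rule Cmp_in[OF Iff v'(1)])
      ultimately have "u' \<cdot> on_ar I f = v' \<cdot> on_ar I f"
        using unit[OF ob(1) u(6) Cmp_in[OF \<eta>A Cmp_in[OF Iff u'(1)]]] by metis
      then have "(u' \<cdot> on_ar I f) \<cdot> h = (v' \<cdot> on_ar I f) \<cdot> h" by simp
      then have "u' = v'" using u'' v'' arr h by simp
      then show "u = v" using u'(2) v'(2) by simp
    qed (rule f)
  next
    assume loc: "X_local f"
    obtain u where u: "u \<in> Ar C" "Dom C u = B" "Cod C u = on_ob I A" "u \<cdot> f = \<eta> A"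
      using X_localE[OF loc, of "\<eta> A"] arr X by (metis B_def)
    obtain v where v: "v \<in> hom C (on_ob I B) (on_ob I A)" "v \<cdot> \<eta> B = u"
      using unit[OF ob(2) X(1), of u] u by (auto simp: in_hom)
    note v' = v(1)[unfolded in_hom]
    have "(v \<cdot> on_ar I f) \<cdot> \<eta> A = v \<cdot> (\<eta> B \<cdot> f)" using arr v' sq by simp
    also have "\<dots> = \<eta> A" using arr v' u by (simp add: comp_triangle[OF v(2)])
    finally have "(v \<cdot> on_ar I f) \<cdot> \<eta> A = \<eta> A" .
    moreover have "v \<cdot> on_ar I f \<in> hom C (on_ob I A) (on_ob I A)" by (rule Cmp_in[OF Iff v(1)])
    moreover have "Idt C (on_ob I A) \<cdot> \<eta> A = \<eta> A" "Idt C (on_ob I A) \<in> hom C (on_ob I A) (on_ob I A)"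
      using arr X subcat Idt_in by auto
    ultimately have 1: "v \<cdot> on_ar I f = Idt C (on_ob I A)" using unit[OF ob(1) X(1) \<eta>A] by metis
    have "(on_ar I f \<cdot> u) \<cdot> f = \<eta> B \<cdot> f" using arr u sq by simp
    then have "on_ar I f \<cdot> u = \<eta> B"
      using arr u(1-3) X by - (rule X_local_cancel[OF loc], auto)
    then have "(on_ar I f \<cdot> v) \<cdot> \<eta> B = \<eta> B" using arr v' v(2) by simp
    moreover have "on_ar I f \<cdot> v \<in> hom C (on_ob I B) (on_ob I B)" by (rule Cmp_in[OF v(1) Iff])
    moreover have "Idt C (on_ob I B) \<cdot> \<eta> B = \<eta> B" "Idt C (on_ob I B) \<in> hom C (on_ob I B) (on_ob I B)"
      using arr X subcat Idt_in by auto
    ultimately have 2: "on_ar I f \<cdot> v = Idt C (on_ob I B)" using unit[OF ob(2) X(2) \<eta>B] by metis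
    show "iso C (on_ar I f)" by (rule isoI[OF Iff v(1) 1 2])
  qed
  then show ?thesis using f iso_full_subcat[OF X Iff] unfolding refl_E_def by simp
qed

lemma X_local_right_cancel:
  assumes e: "X_local e" and me: "X_local (m \<cdot> e)" and m: "m \<in> Ar C" "Dom C m = Cod C e"
  shows "X_local m"
proof (rule X_localI)
  have e_ar: "e \<in> Ar C" using e unfolding X_local_def by simp
  fix a assume a: "a \<in> Ar C" "Dom C a = Dom C m" "Cod C a \<in> X"
  then obtain u where u: "u \<in> Ar C" "Dom C u = Cod C m" "Cod C u = Cod C a" "u \<cdot> (m \<cdot> e) = a \<cdot> e"
    using X_localE[OF me, of "a \<cdot> e"] e_ar m by auto
  have "(u \<cdot> m) \<cdot> e = a \<cdot> e" using u m e_ar by simp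
  then have "u \<cdot> m = a" using u(1-3) m a by - (rule X_local_cancel[OF e], auto)
  then show "\<exists>u. u \<in> Ar C \<and> Dom C u = Cod C m \<and> Cod C u = Cod C a \<and> u \<cdot> m = a" using u by blast
next
  have e_ar: "e \<in> Ar C" using e unfolding X_local_def by simp
  fix u v assume u: "u \<in> Ar C" "v \<in> Ar C" "Dom C u = Cod C m" "Dom C v = Cod C m"
        "Cod C u = Cod C v" "Cod C v \<in> X" "u \<cdot> m = v \<cdot> m"
  have "(u \<cdot> m) \<cdot> e = (v \<cdot> m) \<cdot> e" using u(7) by simp
  then have "u \<cdot> (m \<cdot> e) = v \<cdot> (m \<cdot> e)" using u(1-6) m e_ar by simp
  then show "u = v" using u(1-6) m e_ar by - (rule X_local_cancel[OF me], auto)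
qed (rule m)

text \<open>For an arrow of \<open>X\<close> the extension of the top edge along \<open>e\<close> is the only possible diagonal, and its
  compatibility with the bottom edge is an equation between arrows into \<open>X\<close>, which can be checked
  after composing with \<open>e\<close>.\<close>

lemma refl_M_orth:
  assumes m: "m \<in> refl_M C X" and e: "X_local e"
  shows "orth C e m"
  using m unfolding refl_M_def
proof (induction rule: pullback_closure.induct)
  case (base m)
  then have m: "m \<in> Ar C" "Dom C m \<in> X" "Cod C m \<in> X" by (auto simp: full_subcat_def)
  have e_ar: "e \<in> Ar C" using e unfolding X_local_def by simp
  show ?case unfolding orth_def
  proof (intro ballI impI)
    fix a b assume a: "a \<in> hom C (Dom C e) (Dom C m)" and b: "b \<in> hom C (Cod C e) (Cod C m)"
      and eq: "m \<cdot> a = b \<cdot> e"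
    have u: "\<exists>!u. u \<in> hom C (Cod C e) (Dom C m) \<and> u \<cdot> e = a"
      using e m a unfolding X_local_def by blast
    have "m \<cdot> u = b" if "u \<in> hom C (Cod C e) (Dom C m)" "u \<cdot> e = a" for u
    proof (rule X_local_cancel[OF e])
      show "(m \<cdot> u) \<cdot> e = b \<cdot> e" using that m e_ar eq by (simp add: in_hom)
    qed (use that m b in \<open>auto simp: in_hom\<close>)
    then show "\<exists>!d. d \<in> hom C (Cod C e) (Dom C m) \<and> d \<cdot> e = a \<and> m \<cdot> d = b"
      using u by (metis (no_types, lifting))
  qed
next
  case (pull f g q f')
  have "e \<in> Ar C" using e unfolding X_local_def by simp
  then show ?case using pull by (blast intro: orth_pullback)
qed

lemma X_local_refl_M_iso:
  assumes "X_local m" "m \<in> refl_M C X"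
  shows "iso C m"
  using assms refl_M_orth iso_self_orthogonal unfolding X_local_def by blast

end

section \<open>Torsion theories\<close>

locale torsion_pair = normal_cat +
  fixes Y X
  assumes torsion: "torsion_theory C Y X"
begin

lemma torsionfree_objects: "X \<subseteq> Ob C" and torsion_objects: "Y \<subseteq> Ob C"
  using torsion unfolding torsion_theory_def replete_def by auto

lemma torsion_to_torsionfree:
  assumes "f \<in> Ar C" "Dom C f \<in> Y" "Cod C f \<in> X"
  shows "f = zero (Dom C f) (Cod C f)"
proof -
  have f: "f \<in> hom C (Dom C f) (Cod C f)" using assms by (simp add: in_hom)
  then have "zero_arrow C f" using torsion assms unfolding torsion_theory_def by blast
  then show ?thesis using zero_arrow_iff[OF f] by simp
qed

lemma torsion_sequence:
  assumes "A \<in> Ob C"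
  obtains k f where "is_kernel C k f" "is_cokernel C f k" "Cod C k = A" "Dom C k \<in> Y" "Cod C f \<in> X"
  using assms torsion unfolding torsion_theory_def short_exact_def by blast

text \<open>If the torsion part of \<open>A\<close> vanishes, then the quotient of \<open>A\<close> by it is \<open>A\<close> itself. This
  converse of the orthogonality of \<open>Y\<close> and \<open>X\<close> is how objects are shown to be torsion-free below.\<close>

lemma torsionfreeI:
  assumes A: "A \<in> Ob C"
    and s: "\<And>s. s \<in> Ar C \<Longrightarrow> Dom C s \<in> Y \<Longrightarrow> Cod C s = A \<Longrightarrow> s = zero (Dom C s) A"
  shows "A \<in> X"
proof -
  obtain k f where k: "is_kernel C k f" "is_cokernel C f k" "Cod C k = A" "Dom C k \<in> Y" "Cod C f \<in> X"
    using A by (rule torsion_sequence)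
  note K = kernelE[OF k(1)]
  have f: "Dom C f = A" using K k(3) by simp
  have k0: "k = zero (Dom C k) A" using s K k by blast
  have f_epi: "normal_epi C f" using k(2) unfolding normal_epi_def by blast
  have "Idt C A \<cdot> k = zero (Dom C k) (Cod C (Idt C A))" using k0 K k(3) A by simp
  then obtain u where u: "u \<in> Ar C" "Dom C u = Cod C f" "Cod C u = A" "u \<cdot> f = Idt C A"
    using normal_epi_factor[OF f_epi k(1), of "Idt C A"] A f by auto
  have "(f \<cdot> u) \<cdot> f = Idt C (Cod C f) \<cdot> f" using u K f by simp
  then have fu: "f \<cdot> u = Idt C (Cod C f)"
    using u(1-3) K f by - (rule regular_epi_cancel[OF normal_epi_regular_epi[OF f_epi]], auto)
  have "iso C u" using u fu K f by (intro isoI[of u "Cod C f" A f]) (auto simp: in_hom)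
  then have "isomorphic C (Cod C f) A" unfolding isomorphic_def using u by (auto simp: in_hom)
  then show ?thesis using torsion k(5) A unfolding torsion_theory_def replete_def by blast
qed

text \<open>Membership in \<open>M_bar\<close> says that the arrow is monic as far as arrows from torsion objects are
  concerned. In this form the stability properties need no comparison of kernels.\<close>

lemma M_barD:
  assumes f: "f \<in> M_bar C X" and s: "s \<in> Ar C" "Dom C s \<in> Y" "Cod C s = Dom C f"
    "f \<cdot> s = zero (Dom C s) (Cod C f)"
  shows "s = zero (Dom C s) (Dom C f)"
proof -
  obtain k where k: "is_kernel C k f" "Dom C k \<in> X" using f unfolding M_bar_def by blast
  note K = kernelE[OF k(1)]
  obtain u where u: "u \<in> Ar C" "Dom C u = Dom C s" "Cod C u = Dom C k" "k \<cdot> u = s"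
    using kernel_lift[OF k(1) s(1,3,4)] .
  have "u = zero (Dom C s) (Dom C k)" using torsion_to_torsionfree[of u] u s k by simp
  then have "k \<cdot> u = zero (Dom C s) (Dom C f)" using K s by simp
  then show ?thesis using u by simp
qed

lemma M_barI:
  assumes f: "f \<in> Ar C"
    and s: "\<And>s. s \<in> Ar C \<Longrightarrow> Dom C s \<in> Y \<Longrightarrow> Cod C s = Dom C f \<Longrightarrow>
      f \<cdot> s = zero (Dom C s) (Cod C f) \<Longrightarrow> s = zero (Dom C s) (Dom C f)"
  shows "f \<in> M_bar C X"
proof -
  obtain k where k: "is_kernel C k f" using kernel_exists[OF f] .
  note K = kernelE[OF k]
  have "Dom C k \<in> X"
  proof (rule torsionfreeI)
    fix u assume u: "u \<in> Ar C" "Dom C u \<in> Y" "Cod C u = Dom C k"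
    have "f \<cdot> (k \<cdot> u) = zero (Dom C u) (Cod C f)" using K u by (simp add: comp_triangle[OF K(4)])
    then have "k \<cdot> u = zero (Dom C u) (Dom C f)" using s[of "k \<cdot> u"] K u by simp
    also have "\<dots> = k \<cdot> zero (Dom C u) (Dom C k)" using K u by simp
    finally show "u = zero (Dom C u) (Dom C k)" using u K by - (rule kernel_cancel[OF k], auto)
  qed (use K in simp)
  then show ?thesis using f k unfolding M_bar_def by blast
qed

lemma M_bar_arrow: "f \<in> M_bar C X \<Longrightarrow> f \<in> Ar C"
  unfolding M_bar_def by simp

lemma M_bar_pullback:
  assumes f: "f \<in> M_bar C X" and pb: "is_pullback C f g q f'"
  shows "f' \<in> M_bar C X"
proof (rule M_barI)
  note P = pullback_arrows[OF pb]
  fix s assume s: "s \<in> Ar C" "Dom C s \<in> Y" "Cod C s = Dom C f'" "f' \<cdot> s = zero (Dom C s) (Cod C f')"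
  have "f \<cdot> (q \<cdot> s) = g \<cdot> (f' \<cdot> s)" using P s(1-3) by (simp add: comp_triangle[OF P(9)])
  also have "\<dots> = zero (Dom C s) (Cod C f)" using s P by simp
  finally have "q \<cdot> s = zero (Dom C s) (Dom C f)" using M_barD[OF f, of "q \<cdot> s"] s(1-3) P by simp
  then show "s = zero (Dom C s) (Dom C f')" using P s by - (rule pullback_ext[OF pb], auto)
qed (use pullback_arrows[OF pb] in simp)

text \<open>An arrow killed by \<open>f\<close> lifts to the pullback, together with a zero component.\<close>

lemma M_bar_of_pullback:
  assumes pb: "is_pullback C f p q f'" and f': "f' \<in> M_bar C X"
  shows "f \<in> M_bar C X"
proof (rule M_barI)
  note P = pullback_arrows[OF pb]
  fix s assume s: "s \<in> Ar C" "Dom C s \<in> Y" "Cod C s = Dom C f" "f \<cdot> s = zero (Dom C s) (Cod C f)"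
  then obtain u where u: "u \<in> Ar C" "Dom C u = Dom C s" "Cod C u = Dom C q" "q \<cdot> u = s"
      "f' \<cdot> u = zero (Dom C s) (Dom C p)"
    using pullback_lift[OF pb, of s "zero (Dom C s) (Dom C p)"] P by auto
  then have "u = zero (Dom C s) (Dom C f')" using M_barD[OF f', of u] s P by simp
  then have "q \<cdot> u = zero (Dom C s) (Dom C f)" using P s by simp
  then show "s = zero (Dom C s) (Dom C f)" using u by simp
qed (use pullback_arrows[OF pb] in simp)

lemma M_bar_from_torsionfree:
  assumes "f \<in> Ar C" "Dom C f \<in> X"
  shows "f \<in> M_bar C X"
proof (rule M_barI)
  fix s assume "s \<in> Ar C" "Dom C s \<in> Y" "Cod C s = Dom C f"
  then show "s = zero (Dom C s) (Dom C f)" using torsion_to_torsionfree[of s] assms by simp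
qed (rule assms)

text \<open>Closure of \<open>X\<close> under extensions: an arrow from a torsion object into the total object dies in
  the quotient, hence lies in the kernel, hence vanishes.\<close>

lemma M_bar_into_torsionfree:
  assumes f: "f \<in> M_bar C X" and "Cod C f \<in> X"
  shows "Dom C f \<in> X"
proof (rule torsionfreeI)
  note f_ar = M_bar_arrow[OF f]
  fix s assume s: "s \<in> Ar C" "Dom C s \<in> Y" "Cod C s = Dom C f"
  have "f \<cdot> s = zero (Dom C s) (Cod C f)"
    using torsion_to_torsionfree[of "f \<cdot> s"] f_ar s assms(2) by simp
  then show "s = zero (Dom C s) (Dom C f)" using M_barD[OF f s] by simp
qed (use M_bar_arrow[OF f] in simp)

lemma refl_M_subset_M_bar: "refl_M C X \<subseteq> M_bar C X"
proof
  fix f assume "f \<in> refl_M C X"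
  then show "f \<in> M_bar C X" unfolding refl_M_def
  proof (induction rule: pullback_closure.induct)
    case (base f)
    then show ?case by (intro M_bar_from_torsionfree) (auto simp: full_subcat_def)
  next
    case (pull f g q f')
    then show ?case by (blast intro: M_bar_pullback)
  qed
qed

lemma locally_in_refl_M_subset_M_bar: "locally_in C (refl_M C X) \<subseteq> M_bar C X"
  unfolding locally_in_def using M_bar_of_pullback refl_M_subset_M_bar by blast

lemma E_barE:
  assumes "e \<in> E_bar C Y"
  obtains k where "e \<in> Ar C" "normal_epi C e" "regular_epi C e" "is_kernel C k e" "Dom C k \<in> Y"
  using assms normal_epi_regular_epi unfolding E_bar_def by blast

lemma E_bar_pullback:
  assumes e: "e \<in> E_bar C Y" and pb: "is_pullback C e g q e'"
  shows "e' \<in> E_bar C Y"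
proof -
  obtain k where k: "regular_epi C e" "is_kernel C k e" "Dom C k \<in> Y" using e by (rule E_barE)
  obtain k' where "is_kernel C k' e'" "Dom C k' = Dom C k" using kernel_of_pullback[OF pb k(2)] .
  moreover have "regular_epi C e'" by (rule regular_epi_pullback[OF k(1) pb])
  ultimately show ?thesis
    using k(3) pullback_arrows[OF pb] regular_epi_iff_normal_epi unfolding E_bar_def by auto
qed

text \<open>Composing with an isomorphism is a special pullback.\<close>

lemma E_bar_iso_comp:
  assumes e: "e \<in> E_bar C Y" and m: "iso C m" "Dom C m = Cod C e"
  shows "m \<cdot> e \<in> E_bar C Y"
proof -
  have e_ar: "e \<in> Ar C" using e unfolding E_bar_def by simp
  obtain m' where m': "m \<in> Ar C" "m' \<in> Ar C" "Dom C m' = Cod C m" "Cod C m' = Dom C m"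
    "m' \<cdot> m = Idt C (Dom C m)" "m \<cdot> m' = Idt C (Cod C m)" using m(1) by (rule isoE)
  have "is_pullback C e m' (Idt C (Dom C e)) (m \<cdot> e)"
  proof (rule pullbackI)
    show "e \<cdot> Idt C (Dom C e) = m' \<cdot> (m \<cdot> e)" using m' m(2) e_ar by (simp add: comp_triangle[OF m'(5)])
  next
    fix a b assume a: "a \<in> Ar C" "b \<in> Ar C" "Cod C a = Dom C e" "Cod C b = Dom C m'"
      "Dom C b = Dom C a" and eq: "e \<cdot> a = m' \<cdot> b"
    have "(m \<cdot> e) \<cdot> a = m \<cdot> (m' \<cdot> b)" using a m'(1) m(2) e_ar eq by simp
    also have "\<dots> = b" using a m' by (simp add: comp_triangle[OF m'(6)])
    finally show "\<exists>u. u \<in> Ar C \<and> Dom C u = Dom C a \<and> Cod C u = Dom C (Idt C (Dom C e)) \<and>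
        Idt C (Dom C e) \<cdot> u = a \<and> (m \<cdot> e) \<cdot> u = b"
      using a e_ar by (intro exI[of _ a]) simp
  qed (use m' m(2) e_ar in auto)
  then show ?thesis by (rule E_bar_pullback[OF e])
qed

lemma M_bar_comp_iso:
  assumes m: "m \<in> M_bar C X" and e: "iso C e" "Dom C m = Cod C e"
  shows "m \<cdot> e \<in> M_bar C X"
proof (rule M_barI)
  note m_ar = M_bar_arrow[OF m]
  obtain e' where e': "e \<in> Ar C" "e' \<in> Ar C" "Dom C e' = Cod C e" "Cod C e' = Dom C e"
    "e' \<cdot> e = Idt C (Dom C e)" "e \<cdot> e' = Idt C (Cod C e)" using e(1) by (rule isoE)
  show "m \<cdot> e \<in> Ar C" using m_ar e' e(2) by simp
  fix s assume s: "s \<in> Ar C" "Dom C s \<in> Y" "Cod C s = Dom C (m \<cdot> e)"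
    "(m \<cdot> e) \<cdot> s = zero (Dom C s) (Cod C (m \<cdot> e))"
  have c: "Cod C s = Dom C e" using s(3) m_ar e'(1) e(2) by simp
  have "m \<cdot> (e \<cdot> s) = zero (Dom C s) (Cod C m)" using s(1,4) c m_ar e'(1) e(2) by simp
  then have es: "e \<cdot> s = zero (Dom C s) (Dom C m)"
    using M_barD[OF m, of "e \<cdot> s"] s(1,2) c e'(1) e(2) by simp
  have "s = e' \<cdot> (e \<cdot> s)" using s(1) c e'(1-5) by (simp add: comp_triangle[OF e'(5)])
  also have "\<dots> = zero (Dom C s) (Dom C e)" unfolding es using s(1) e' e(2) by simp
  finally show "s = zero (Dom C s) (Dom C (m \<cdot> e))" using m_ar e'(1) e(2) by simp
qed

text \<open>The composite of the kernel of \<open>e\<close> with the top edge of a square lands in the torsion-free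
  kernel of \<open>m\<close>, hence vanishes, so the top edge factors through the normal epimorphism \<open>e\<close>.\<close>

lemma E_bar_orth_M_bar:
  assumes e: "e \<in> E_bar C Y" and m: "m \<in> M_bar C X"
  shows "orth C e m"
  unfolding orth_def
proof (intro ballI impI)
  fix a b assume "a \<in> hom C (Dom C e) (Dom C m)" "b \<in> hom C (Cod C e) (Cod C m)" and eq: "m \<cdot> a = b \<cdot> e"
  then have a: "a \<in> Ar C" "Dom C a = Dom C e" "Cod C a = Dom C m"
    and b: "b \<in> Ar C" "Dom C b = Cod C e" "Cod C b = Cod C m" by (auto simp: in_hom)
  note m_ar = M_bar_arrow[OF m]
  obtain k where k: "e \<in> Ar C" "normal_epi C e" "regular_epi C e" "is_kernel C k e" "Dom C k \<in> Y"
    using e by (rule E_barE)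
  note K = kernelE[OF k(4)]
  have "m \<cdot> (a \<cdot> k) = b \<cdot> (e \<cdot> k)" using a b K m_ar by (simp add: comp_triangle[OF eq] del: K(4))
  also have "\<dots> = zero (Dom C k) (Cod C m)" using K b by simp
  finally have "a \<cdot> k = zero (Dom C k) (Cod C a)" using M_barD[OF m, of "a \<cdot> k"] a K k(5) by simp
  then obtain d where d: "d \<in> Ar C" "Dom C d = Cod C e" "Cod C d = Cod C a" "d \<cdot> e = a"
    using normal_epi_factor[OF k(2,4) a(1,2)] by blast
  have "(m \<cdot> d) \<cdot> e = b \<cdot> e" using d a m_ar k(1) eq by simp
  then have md: "m \<cdot> d = b" using d(1-3) a b m_ar by - (rule regular_epi_cancel[OF k(3)], auto)
  show "\<exists>!d. d \<in> hom C (Cod C e) (Dom C m) \<and> d \<cdot> e = a \<and> m \<cdot> d = b"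
  proof (rule ex1I[of _ d])
    show "d \<in> hom C (Cod C e) (Dom C m) \<and> d \<cdot> e = a \<and> m \<cdot> d = b" using d md a by (simp add: in_hom)
  next
    fix d' assume "d' \<in> hom C (Cod C e) (Dom C m) \<and> d' \<cdot> e = a \<and> m \<cdot> d' = b"
    then have "d' \<in> Ar C" "Dom C d' = Cod C e" "Cod C d' = Dom C m" "d' \<cdot> e = d \<cdot> e"
      using d by (auto simp: in_hom)
    then show "d' = d" using d(1-3) a by - (rule regular_epi_cancel[OF k(3)], auto)
  qed
qed

end


section \<open>The factorisation system of the torsion theory\<close>

locale normal_torsion_pair = torsion_pair +
  fixes T t
  assumes coreflector: "coreflector C Y T t"
    and normal_torsion: "normal_mono C k \<Longrightarrow> normal_mono C (k \<cdot> t (Dom C k))"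
begin

lemma torsion_part:
  assumes A: "A \<in> Ob C"
  shows "t A \<in> Ar C" "Cod C (t A) = A" "Dom C (t A) \<in> Y"
    and "\<And>s. s \<in> Ar C \<Longrightarrow> Dom C s \<in> Y \<Longrightarrow> Cod C s = A \<Longrightarrow>
      \<exists>!u. u \<in> hom C (Dom C s) (Dom C (t A)) \<and> t A \<cdot> u = s"
proof -
  have hom_full: "hom (full_subcat C Y) S S' = hom C S S'" if "S \<in> Y" "S' \<in> Y" for S S'
    using that by (auto simp: full_subcat_def hom_def)
  obtain \<eta> where adj: "adjunction (full_subcat C Y) C id_ftor T \<eta> t"
    using coreflector unfolding coreflector_def by blast
  have Tf: "is_functor C (full_subcat C Y) T" and t: "nat_trans C C (comp_ftor id_ftor T) id_ftor t"
    using adj unfolding adjunction_def by auto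
  have tA: "t A \<in> hom C (on_ob T A) A" using nat_trans_hom[OF t A] by simp
  have TA: "on_ob T A \<in> Y" using functor_ob[OF Tf A] by (simp add: full_subcat_def)
  show "t A \<in> Ar C" "Cod C (t A) = A" "Dom C (t A) \<in> Y" using tA TA by (simp_all add: in_hom)
  fix s assume s: "s \<in> Ar C" "Dom C s \<in> Y" "Cod C s = A"
  have "Dom C s \<in> Ob (full_subcat C Y)" "s \<in> hom C (on_ob id_ftor (Dom C s)) A"
    using s by (simp_all add: full_subcat_def in_hom)
  from adjunction_counit_universal[OF adj this(1) A this(2)]
  show "\<exists>!u. u \<in> hom C (Dom C s) (Dom C (t A)) \<and> t A \<cdot> u = s"
    using s(2) TA tA by (simp add: hom_full in_hom)
qed

text \<open>The counit is the kernel of the torsion-free quotient: the torsion subobject supplied by the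
  torsion theory has the universal property of the coreflection, so the two agree.\<close>

lemma torsion_part_kernel:
  assumes A: "A \<in> Ob C"
  obtains r where "r \<in> Ar C" "Dom C r = A" "Cod C r \<in> X" "is_kernel C (t A) r"
proof -
  obtain k r where k: "is_kernel C k r" "Cod C k = A" "Dom C k \<in> Y" "Cod C r \<in> X"
    using A by (rule torsion_sequence)
  note K = kernelE[OF k(1)] and tA = torsion_part(1-3)[OF A]
  have r: "Dom C r = A" using K k(2) by simp
  have rt: "r \<cdot> t A = zero (Dom C (t A)) (Cod C r)"
    using torsion_to_torsionfree[of "r \<cdot> t A"] K r tA k(4) by simp
  obtain w where w: "w \<in> Ar C" "Dom C w = Dom C (t A)" "Cod C w = Dom C k" "k \<cdot> w = t A"
    using kernel_lift[OF k(1) tA(1) _ rt] r tA by auto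
  obtain v where v: "v \<in> hom C (Dom C k) (Dom C (t A))" "t A \<cdot> v = k"
    using torsion_part(4)[OF A, of k] K k by blast
  note v' = v(1)[unfolded in_hom]
  have "t A \<cdot> (v \<cdot> w) = t A" using tA v' w by (simp add: comp_triangle[OF v(2)])
  moreover have "v \<cdot> w \<in> hom C (Dom C (t A)) (Dom C (t A))"
    "Idt C (Dom C (t A)) \<in> hom C (Dom C (t A)) (Dom C (t A))" "t A \<cdot> Idt C (Dom C (t A)) = t A"
    using tA v' w by (simp_all add: in_hom)
  ultimately have vw: "v \<cdot> w = Idt C (Dom C (t A))"
    using torsion_part(4)[OF A tA(1,3,2)] by metis
  have "is_kernel C (t A) r"
  proof (rule kernelI)
    fix a assume a: "a \<in> Ar C" "Cod C a = Dom C r" "r \<cdot> a = zero (Dom C a) (Cod C r)"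
    then obtain x where x: "x \<in> Ar C" "Dom C x = Dom C a" "Cod C x = Dom C k" "k \<cdot> x = a"
      using kernel_lift[OF k(1)] by blast
    then have "t A \<cdot> (v \<cdot> x) = a" using tA v' by (simp add: comp_triangle[OF v(2)])
    then show "\<exists>u. u \<in> Ar C \<and> Dom C u = Dom C a \<and> Cod C u = Dom C (t A) \<and> t A \<cdot> u = a"
      using v' x by (intro exI[of _ "v \<cdot> x"]) simp
  next
    fix u u' assume u: "u \<in> Ar C" "u' \<in> Ar C" "Cod C u = Dom C (t A)" "Cod C u' = Dom C (t A)"
       "Dom C u' = Dom C u" "t A \<cdot> u = t A \<cdot> u'"
    have kw: "k \<cdot> (w \<cdot> x) = t A \<cdot> x" if "x \<in> Ar C" "Cod C x = Dom C (t A)" for x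
      using that K w k(2) by (simp add: comp_triangle[OF w(4)])
    have "k \<cdot> (w \<cdot> u) = k \<cdot> (w \<cdot> u')" using kw[OF u(1,3)] kw[OF u(2,4)] u(6) by simp
    then have "w \<cdot> u = w \<cdot> u'" using u(1-5) w(1-3) by - (rule kernel_cancel[OF k(1)], auto)
    then have "v \<cdot> (w \<cdot> u) = v \<cdot> (w \<cdot> u')" by simp
    then show "u = u'" using u(1-5) w(1-3) v' tA by (simp add: comp_triangle[OF vw])
  qed (use tA r K rt in auto)
  then show ?thesis using that K r k(4) by blast
qed

text \<open>The arrow \<open>f\<close> factors through the quotient \<open>q\<close> of its domain by the torsion part of its kernel
  \<open>k\<close>, a quotient that exists because this torsion part is a normal subobject. The remaining arrow
  \<open>m\<close> is in \<open>M_bar\<close>, its kernel being the torsion-free quotient of the kernel of \<open>f\<close>. The proof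
  shows this on generalised elements: an arrow \<open>s\<close> from a torsion object that is killed by \<open>m\<close> is
  lifted along \<open>q\<close>, on a cover \<open>q'\<close> of its domain, to the kernel of \<open>f\<close>, and the image of the lift in
  the torsion-free quotient descends along \<open>q'\<close> to an arrow out of a torsion object.\<close>

lemma bar_factorisation:
  assumes f: "f \<in> Ar C"
  shows "\<exists>e \<in> E_bar C Y. \<exists>m \<in> M_bar C X. Cod C e = Dom C m \<and> f = m \<cdot> e"
proof -
  obtain k where k: "is_kernel C k f" using kernel_exists[OF f] .
  note K = kernelE[OF k]
  define A where "A = Dom C k"
  have A: "A \<in> Ob C" unfolding A_def using K by simp
  note tA = torsion_part(1-3)[OF A]
  obtain r where r: "r \<in> Ar C" "Dom C r = A" "Cod C r \<in> X" "is_kernel C (t A) r"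
    using torsion_part_kernel[OF A] .
  define n where "n = k \<cdot> t A"
  have n: "n \<in> Ar C" "Dom C n = Dom C (t A)" "Cod C n = Dom C f"
    unfolding n_def using K tA by (simp_all add: A_def)
  have "normal_mono C k" using k unfolding normal_mono_def by blast
  then have "normal_mono C n" unfolding n_def A_def by (rule normal_torsion)
  then obtain g where "is_kernel C n g" unfolding normal_mono_def by blast
  then obtain q where q: "regular_epi C q" "is_kernel C n q" by (rule kernel_of_regular_epi)
  note Q = kernelE[OF q(2)]
  have q_normal: "normal_epi C q" using q(1) regular_epi_iff_normal_epi by simp
  have q_dom: "Dom C q = Dom C f" using Q n by simp
  have qE: "q \<in> E_bar C Y" unfolding E_bar_def using Q(2) q_normal q(2) n(2) tA(3) by auto
  have "f \<cdot> n = zero (Dom C n) (Cod C f)"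
    unfolding n_def using K tA by (simp add: comp_triangle[OF K(4)] A_def)
  then obtain m where m: "m \<in> Ar C" "Dom C m = Cod C q" "Cod C m = Cod C f" "m \<cdot> q = f"
    using normal_epi_factor[OF q_normal q(2), of f] f q_dom by auto
  have "m \<in> M_bar C X"
  proof (rule M_barI)
    fix s assume s: "s \<in> Ar C" "Dom C s \<in> Y" "Cod C s = Dom C m" "m \<cdot> s = zero (Dom C s) (Cod C m)"
    obtain p q' where pb: "is_pullback C q s p q'"
      using pullback_exists[OF finite_limits Q(2) s(1)] s(3) m(2) by auto
    note P = pullback_arrows[OF pb]
    have q': "regular_epi C q'" by (rule regular_epi_pullback[OF q(1) pb])
    obtain k' where k': "is_kernel C k' q'" "Dom C k' = Dom C n" "p \<cdot> k' = n"
      using kernel_of_pullback[OF pb q(2)] .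
    note K' = kernelE[OF k'(1)]
    have "f \<cdot> p = m \<cdot> (q \<cdot> p)" by (subst m(4)[symmetric]) (use m(1,2) P in simp)
    also have "\<dots> = (m \<cdot> s) \<cdot> q'" unfolding P(9) using m(1) s(1,3) P by simp
    also have "\<dots> = zero (Dom C p) (Cod C f)" unfolding s(4) using P m s f by simp
    finally obtain w where w: "w \<in> Ar C" "Dom C w = Dom C p" "Cod C w = A" "k \<cdot> w = p"
      using kernel_lift[OF k, of p] P q_dom by (auto simp: A_def)
    have wk: "w \<cdot> k' = t A"
    proof (rule kernel_cancel[OF k])
      show "k \<cdot> (w \<cdot> k') = k \<cdot> t A"
        using w K K' k'(3) P by (simp add: comp_triangle[OF w(4)] n_def A_def)
    qed (use w K' P k'(2) n(2) tA in \<open>auto simp: A_def\<close>)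
    have "(r \<cdot> w) \<cdot> k' = r \<cdot> t A" using r w K' P wk by simp
    also have "\<dots> = zero (Dom C k') (Cod C r)" using kernelE(4)[OF r(4)] k'(2) n(2) by simp
    finally obtain v where v: "v \<in> Ar C" "Dom C v = Cod C q'" "Cod C v = Cod C r" "v \<cdot> q' = r \<cdot> w"
      using normal_epi_factor[OF _ k'(1), of "r \<cdot> w"] q' regular_epi_iff_normal_epi r w P by auto
    have "v = zero (Dom C s) (Cod C r)" using torsion_to_torsionfree[of v] v r s P by simp
    then have "r \<cdot> w = zero (Dom C w) (Cod C r)" using v(4) P r w by simp
    then obtain x where x: "x \<in> Ar C" "Dom C x = Dom C w" "Cod C x = Dom C (t A)" "t A \<cdot> x = w"
      using kernel_lift[OF r(4), of w] w r by auto
    have "n \<cdot> x = k \<cdot> w" unfolding n_def using K tA x by (simp add: A_def)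
    then have nx: "n \<cdot> x = p" using w(4) by simp
    have "s \<cdot> q' = q \<cdot> (n \<cdot> x)" unfolding nx using P(9) by simp
    also have "\<dots> = zero (Dom C x) (Cod C q)" using Q n x by (simp add: comp_triangle[OF Q(4)])
    also have "\<dots> = zero (Dom C s) (Dom C m) \<cdot> q'" using P m x w s by simp
    finally show "s = zero (Dom C s) (Dom C m)"
      using P m s(1,3) by - (rule regular_epi_cancel[OF q'], auto)
  qed (rule m(1))
  then show ?thesis using qE m by (intro bexI[of _ q] bexI[of _ m]) auto
qed

text \<open>Two mutually orthogonal classes that contain a factorisation of every arrow and are closed under
  composition with isomorphisms determine each other: an arrow of \<open>orth_left\<close> is orthogonal to the
  second factor of its factorisation, which is therefore an isomorphism, and dually.\<close>

theorem bar_factorisation_system: "factorisation_system C (E_bar C Y) (M_bar C X)"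
proof -
  have "f \<in> E_bar C Y" if "f \<in> orth_left C (M_bar C X)" for f
  proof -
    have f: "f \<in> Ar C" "\<And>m. m \<in> M_bar C X \<Longrightarrow> orth C f m" using that unfolding orth_left_def by auto
    obtain e m where em: "e \<in> E_bar C Y" "m \<in> M_bar C X" "Cod C e = Dom C m" "f = m \<cdot> e"
      using bar_factorisation[OF f(1)] by blast
    have ar: "e \<in> Ar C" "m \<in> Ar C" using em(1) M_bar_arrow[OF em(2)] unfolding E_bar_def by auto
    have fdc: "Dom C f = Dom C e" "Cod C f = Cod C m" using em(3,4) ar by simp_all
    have "\<exists>!d. d \<in> hom C (Cod C f) (Dom C m) \<and> d \<cdot> f = e \<and> m \<cdot> d = Idt C (Cod C m)"
      using ar em(3,4) f(1) fdc by (intro orthD[OF f(2)[OF em(2)]]) (auto simp: in_hom)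
    then obtain d where d: "d \<in> hom C (Cod C m) (Dom C m)" "d \<cdot> f = e" "m \<cdot> d = Idt C (Cod C m)"
      unfolding fdc by blast
    note d' = d(1)[unfolded in_hom]
    have uniq: "\<exists>!x. x \<in> hom C (Cod C e) (Dom C m) \<and> x \<cdot> e = e \<and> m \<cdot> x = m"
      using ar em(3) by (intro orthD[OF E_bar_orth_M_bar[OF em(1,2)]]) (auto simp: in_hom)
    have "(d \<cdot> m) \<cdot> e = e" using d(2) d' ar em(3,4) by simp
    moreover have "m \<cdot> (d \<cdot> m) = m" using d' ar by (simp add: comp_triangle[OF d(3)])
    moreover have "d \<cdot> m \<in> hom C (Cod C e) (Dom C m)" using d' ar em(3) by (simp add: in_hom)
    moreover have "Idt C (Dom C m) \<in> hom C (Cod C e) (Dom C m)" "Idt C (Dom C m) \<cdot> e = e"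
      "m \<cdot> Idt C (Dom C m) = m" using ar em(3) by (simp_all add: in_hom)
    ultimately have "d \<cdot> m = Idt C (Dom C m)" using uniq by metis
    then have "iso C m" using d ar by (intro isoI[of m _ _ d]) (auto simp: in_hom)
    then show ?thesis unfolding em(4) using E_bar_iso_comp[OF em(1)] em(3) by simp
  qed
  moreover have "f \<in> M_bar C X" if "f \<in> orth_right C (E_bar C Y)" for f
  proof -
    have f: "f \<in> Ar C" "\<And>e. e \<in> E_bar C Y \<Longrightarrow> orth C e f" using that unfolding orth_right_def by auto
    obtain e m where em: "e \<in> E_bar C Y" "m \<in> M_bar C X" "Cod C e = Dom C m" "f = m \<cdot> e"
      using bar_factorisation[OF f(1)] by blast
    have ar: "e \<in> Ar C" "m \<in> Ar C" using em(1) M_bar_arrow[OF em(2)] unfolding E_bar_def by auto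
    have fdc: "Dom C f = Dom C e" "Cod C f = Cod C m" using em(3,4) ar by simp_all
    have "\<exists>!d. d \<in> hom C (Cod C e) (Dom C f) \<and> d \<cdot> e = Idt C (Dom C e) \<and> f \<cdot> d = m"
      using ar em(3,4) f(1) fdc by (intro orthD[OF f(2)[OF em(1)]]) (auto simp: in_hom)
    then obtain d where d: "d \<in> hom C (Cod C e) (Dom C e)" "d \<cdot> e = Idt C (Dom C e)" "f \<cdot> d = m"
      unfolding fdc by blast
    note d' = d(1)[unfolded in_hom]
    have uniq: "\<exists>!x. x \<in> hom C (Cod C e) (Dom C m) \<and> x \<cdot> e = e \<and> m \<cdot> x = m"
      using ar em(3) by (intro orthD[OF E_bar_orth_M_bar[OF em(1,2)]]) (auto simp: in_hom)
    have "(e \<cdot> d) \<cdot> e = e" using d(2) d' ar by simp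
    moreover have "m \<cdot> (e \<cdot> d) = m" using d(3) d' ar em(3,4) by simp
    moreover have "e \<cdot> d \<in> hom C (Cod C e) (Dom C m)" using d' ar em(3) by (simp add: in_hom)
    moreover have "Idt C (Dom C m) \<in> hom C (Cod C e) (Dom C m)" "Idt C (Dom C m) \<cdot> e = e"
      "m \<cdot> Idt C (Dom C m) = m" using ar em(3) by (simp_all add: in_hom)
    ultimately have "e \<cdot> d = Idt C (Cod C e)" using uniq em(3) by metis
    then have "iso C e" using d ar by (intro isoI[of e _ _ d]) (auto simp: in_hom)
    then show ?thesis unfolding em(4) using M_bar_comp_iso[OF em(2)] em(3) by simp
  qed
  moreover have "e \<in> orth_left C (M_bar C X)" if "e \<in> E_bar C Y" for e
    using that E_bar_orth_M_bar[OF that] unfolding orth_left_def E_bar_def by simp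
  moreover have "m \<in> orth_right C (E_bar C Y)" if "m \<in> M_bar C X" for m
    using M_bar_arrow[OF that] E_bar_orth_M_bar[OF _ that] unfolding orth_right_def by simp
  ultimately show ?thesis
    unfolding factorisation_system_def by (intro conjI ballI subset_antisym subsetI bar_factorisation)
qed

end


section \<open>Comparison with the stabilised and localised classes\<close>

locale reflective_normal_torsion_pair = normal_torsion_pair +
  fixes I
  assumes is_reflector: "reflector C X I"

sublocale reflective_normal_torsion_pair \<subseteq> reflection C X I
  by unfold_locales (use torsionfree_objects is_reflector in auto)

context reflective_normal_torsion_pair
begin

text \<open>An arrow to a torsion-free object kills the torsion kernel of \<open>e\<close>, hence factors through \<open>e\<close>.\<close>

lemma E_bar_X_local:
  assumes e: "e \<in> E_bar C Y"
  shows "X_local e"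
proof -
  obtain k where k: "e \<in> Ar C" "normal_epi C e" "regular_epi C e" "is_kernel C k e" "Dom C k \<in> Y"
    using e by (rule E_barE)
  note K = kernelE[OF k(4)]
  show ?thesis
  proof (rule X_localI)
    fix a assume a: "a \<in> Ar C" "Dom C a = Dom C e" "Cod C a \<in> X"
    have "a \<cdot> k = zero (Dom C k) (Cod C a)" using torsion_to_torsionfree[of "a \<cdot> k"] a K k(5) by simp
    then obtain u where "u \<in> Ar C" "Dom C u = Cod C e" "Cod C u = Cod C a" "u \<cdot> e = a"
      using normal_epi_factor[OF k(2,4) a(1,2)] by blast
    then show "\<exists>u. u \<in> Ar C \<and> Dom C u = Cod C e \<and> Cod C u = Cod C a \<and> u \<cdot> e = a" by blast
  next
    fix u v assume "u \<in> Ar C" "v \<in> Ar C" "Dom C u = Cod C e" "Dom C v = Cod C e"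
      "Cod C u = Cod C v" "Cod C v \<in> X" "u \<cdot> e = v \<cdot> e"
    then show "u = v" by - (rule regular_epi_cancel[OF k(3)], auto)
  qed (rule k(1))
qed

lemma E_bar_subset_stably_refl_E: "E_bar C Y \<subseteq> stably_in C (refl_E C X I)"
proof
  fix e assume e: "e \<in> E_bar C Y"
  then have "e \<in> Ar C" unfolding E_bar_def by simp
  moreover have "e' \<in> refl_E C X I" if "is_pullback C e g q e'" for g q e'
    using E_bar_X_local[OF E_bar_pullback[OF e that]] refl_E_iff by simp
  ultimately show "e \<in> stably_in C (refl_E C X I)" unfolding stably_in_def by simp
qed

text \<open>Factor \<open>f\<close>, stably inverted by the reflector, through \<open>e\<close> in \<open>E_bar\<close> and \<open>m\<close> in \<open>M_bar\<close>. Locally,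
  \<open>m\<close> lies in \<open>refl_M\<close>; it is also locally inverted by the reflector, since \<open>f\<close> and \<open>e\<close> are. So it is
  locally an isomorphism, and effective descent makes it one.\<close>

lemma stably_refl_E_eq_E_bar:
  assumes M: "locally_in C (refl_M C X) = M_bar C X"
  shows "stably_in C (refl_E C X I) = E_bar C Y"
proof
  show "stably_in C (refl_E C X I) \<subseteq> E_bar C Y"
  proof
    fix f assume stab: "f \<in> stably_in C (refl_E C X I)"
    then have f: "f \<in> Ar C" unfolding stably_in_def by simp
    obtain e m where em: "e \<in> E_bar C Y" "m \<in> M_bar C X" "Cod C e = Dom C m" "f = m \<cdot> e"
      using bar_factorisation[OF f] by blast
    have ar: "e \<in> Ar C" "m \<in> Ar C" using em(1) M_bar_arrow[OF em(2)] unfolding E_bar_def by auto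
    obtain p q m' where p: "effective_descent C p" and pm: "is_pullback C m p q m'" and m': "m' \<in> refl_M C X"
      using em(2) M unfolding locally_in_def by blast
    note P = pullback_arrows[OF pm]
    obtain r e' where pe: "is_pullback C e q r e'"
      using pullback_exists[OF finite_limits ar(1), of q] P em(3) by auto
    have "is_pullback C f p r (m' \<cdot> e')"
      unfolding em(4) using pullback_paste_along[OF ar _ pm pe] em(3) by simp
    then have "X_local (m' \<cdot> e')" using pullback_stably_in[OF stab] refl_E_iff by blast
    moreover have "X_local e'" using E_bar_X_local[OF E_bar_pullback[OF em(1) pe]] .
    ultimately have "X_local m'"
      using P pullback_arrows[OF pe] X_local_right_cancel[of e' m'] by auto
    then have "iso C m'" using m' by (rule X_local_refl_M_iso)
    then have "iso C m" by (rule effective_descent_reflects_iso[OF finite_limits p pm])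
    then show "f \<in> E_bar C Y" unfolding em(4) using E_bar_iso_comp[OF em(1)] em(3) by simp
  qed
qed (rule E_bar_subset_stably_refl_E)

text \<open>Over a torsion-free base every arrow of \<open>M_bar\<close> has a torsion-free domain, hence is an arrow of
  \<open>X\<close>; so pulling back along a torsion-free cover of the codomain is enough.\<close>

lemma torsionfree_covers_imp:
  assumes cover: "\<And>B. B \<in> Ob C \<Longrightarrow> \<exists>p. effective_descent C p \<and> Cod C p = B \<and> Dom C p \<in> X"
  shows "locally_in C (refl_M C X) = M_bar C X"
proof
  show "M_bar C X \<subseteq> locally_in C (refl_M C X)"
  proof
    fix f assume f: "f \<in> M_bar C X"
    note f_ar = M_bar_arrow[OF f]
    obtain p where p: "effective_descent C p" "Cod C p = Cod C f" "Dom C p \<in> X"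
      using cover[of "Cod C f"] f_ar by auto
    have p_ar: "p \<in> Ar C" using p(1) unfolding effective_descent_def by simp
    obtain q f' where pb: "is_pullback C f p q f'"
      using pullback_exists[OF finite_limits f_ar p_ar] p(2) by auto
    note P = pullback_arrows[OF pb]
    have "Dom C f' \<in> X" using M_bar_into_torsionfree[OF M_bar_pullback[OF f pb]] P p(3) by simp
    then have "f' \<in> refl_M C X"
      unfolding refl_M_def using P p(3) by (intro pullback_closure.base) (simp add: full_subcat_def)
    then show "f \<in> locally_in C (refl_M C X)" unfolding locally_in_def using f_ar p(1) pb by blast
  qed
qed (rule locally_in_refl_M_subset_M_bar)

lemma zero_to_torsion_X_local:
  assumes Z: "zero_object C Z" and e: "e \<in> hom C Z S" and S: "S \<in> Y"
  shows "X_local e"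
proof (rule X_localI)
  note e' = e[unfolded in_hom]
  show "e \<in> Ar C" using e' by simp
  fix a assume a: "a \<in> Ar C" "Dom C a = Dom C e" "Cod C a \<in> X"
  then have z: "zero S (Cod C a) \<in> hom C S (Cod C a)"
    using S torsion_objects by (intro zero_hom) auto
  have "zero S (Cod C a) \<cdot> e = a"
    using from_zero_unique[OF Z Cmp_in[OF e z]] a e' by (simp add: in_hom)
  then show "\<exists>u. u \<in> Ar C \<and> Dom C u = Cod C e \<and> Cod C u = Cod C a \<and> u \<cdot> e = a"
    using z e' by (auto simp: in_hom)
next
  fix u v assume "u \<in> Ar C" "v \<in> Ar C" "Dom C u = Cod C e" "Dom C v = Cod C e"
    "Cod C u = Cod C v" "Cod C v \<in> X"
  then show "u = v" using torsion_to_torsionfree[of u] torsion_to_torsionfree[of v] e S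
    by (simp add: in_hom)
qed

text \<open>The arrow \<open>0 \<rightarrow> P\<close> has zero kernel, so it is locally in \<open>refl_M\<close>; as the covering morphism splits
  by projectivity, it is in \<open>refl_M\<close> itself. Orthogonality to \<open>0 \<rightarrow> S\<close>, for \<open>S\<close> torsion, then factors
  every arrow \<open>S \<rightarrow> P\<close> through zero.\<close>

lemma descent_projective_torsionfree:
  assumes M: "locally_in C (refl_M C X) = M_bar C X" and P: "descent_projective C P"
  shows "P \<in> X"
proof -
  have P_ob: "P \<in> Ob C" using P unfolding descent_projective_def by simp
  obtain Z where Z: "zero_object C Z" using pointed unfolding pointed_def by blast
  then obtain m where m: "m \<in> hom C Z P" using P_ob by (rule zero_object_arrows)
  note m' = m[unfolded in_hom]
  have Z_ob: "Z \<in> Ob C" using hom_objects[OF m] by simp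
  have "m \<in> M_bar C X"
  proof (rule M_barI)
    fix s assume s: "s \<in> Ar C" "Dom C s \<in> Y" "Cod C s = Dom C m"
    have "s \<in> hom C (Dom C s) Z" "zero (Dom C s) Z \<in> hom C (Dom C s) Z"
      using s m' zero_hom[of "Dom C s" Z] Z_ob by (auto simp: in_hom)
    then show "s = zero (Dom C s) (Dom C m)" using to_zero_unique[OF Z] m' by blast
  qed (use m' in simp)
  then obtain p q f' where p: "effective_descent C p" and pb: "is_pullback C m p q f'" and f': "f' \<in> refl_M C X"
    using M unfolding locally_in_def by blast
  note Q = pullback_arrows[OF pb]
  have "Idt C P \<in> hom C P (Cod C p)" using Idt_in[OF P_ob] Q m' by simp
  then obtain g where g: "g \<in> hom C P (Dom C p)" "p \<cdot> g = Idt C P"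
    using P p unfolding descent_projective_def by blast
  have "\<exists>r. is_pullback C f' g r m"
    using g Q m' by (intro pullback_along_section[OF pb]) (auto simp: in_hom)
  then obtain r where "is_pullback C f' g r m" ..
  with f' have mM: "m \<in> refl_M C X" unfolding refl_M_def by (rule pullback_closure.pull)
  show ?thesis
  proof (rule torsionfreeI[OF P_ob])
    fix s assume s: "s \<in> Ar C" "Dom C s \<in> Y" "Cod C s = P"
    then have "Dom C s \<in> Ob C" by simp
    with Z obtain e where e: "e \<in> hom C Z (Dom C s)" by (rule zero_object_arrows)
    have sh: "s \<in> hom C (Dom C s) P" using s by (simp add: in_hom)
    have "m \<cdot> Idt C Z = s \<cdot> e"
      by (rule from_zero_unique[OF Z Cmp_in[OF Idt_in[OF Z_ob] m] Cmp_in[OF e sh]])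
    then have "\<exists>!d. d \<in> hom C (Cod C e) (Dom C m) \<and> d \<cdot> e = Idt C Z \<and> m \<cdot> d = s"
      using e m' sh Idt_in[OF Z_ob]
      by (intro orthD[OF refl_M_orth[OF mM zero_to_torsion_X_local[OF Z e s(2)]]]) (auto simp: in_hom)
    then obtain d where d: "d \<in> hom C (Dom C s) Z" "m \<cdot> d = s"
      using e m' by (auto simp: in_hom)
    then show "s = zero (Dom C s) P" using zero_through[OF Z d(1) m] by simp
  qed
qed

end


section \<open>Torsion-free covers and monotone-light factorisation\<close>

theorem theorem1p6:
  fixes C :: "('o, 'm) cat" and Y X :: "'o set"
    and I T :: "('o, 'm, 'o, 'm) ftor" and t :: "'o \<Rightarrow> 'm"
  assumes "normal_category C"
    and "torsion_theory C Y X"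
    and "reflector C X I"
    and "coreflector C Y T t"
    and "\<And>k. normal_mono C k \<Longrightarrow> normal_mono C (k \<cdot>\<^bsub>C\<^esub> t (Dom C k))"
  shows "((\<forall>B \<in> Ob C. \<exists>p. effective_descent C p \<and> Cod C p = B \<and> Dom C p \<in> X)
            \<longrightarrow> locally_in C (refl_M C X) = M_bar C X)
       \<and> (locally_in C (refl_M C X) = M_bar C X
            \<longrightarrow> stably_in C (refl_E C X I) = E_bar C Y)
       \<and> (locally_in C (refl_M C X) = M_bar C X
            \<longrightarrow> factorisation_system C (stably_in C (refl_E C X I)) (locally_in C (refl_M C X)))
       \<and> (enough_descent_projectives C \<longrightarrow>
            locally_in C (refl_M C X) = M_bar C X
            \<longrightarrow> (\<forall>B \<in> Ob C. \<exists>p. effective_descent C p \<and> Cod C p = B \<and> Dom C p \<in> X))"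
proof -
  interpret category C
    using assms(1) unfolding normal_category_def pointed_def by blast
  interpret reflective_normal_torsion_pair C Y X T t I
    by unfold_locales (use assms in auto)
  show ?thesis
  proof (intro conjI impI ballI)
    assume "\<forall>B \<in> Ob C. \<exists>p. effective_descent C p \<and> Cod C p = B \<and> Dom C p \<in> X"
    then show "locally_in C (refl_M C X) = M_bar C X" by (intro torsionfree_covers_imp) blast
  next
    assume M: "locally_in C (refl_M C X) = M_bar C X"
    then show "stably_in C (refl_E C X I) = E_bar C Y" by (rule stably_refl_E_eq_E_bar)
    then show "factorisation_system C (stably_in C (refl_E C X I)) (locally_in C (refl_M C X))"
      using bar_factorisation_system M by simp
  next
    fix B assume "enough_descent_projectives C" and M: "locally_in C (refl_M C X) = M_bar C X" and "B \<in> Ob C"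
    then obtain p where "effective_descent C p" "Cod C p = B" "descent_projective C (Dom C p)"
      unfolding enough_descent_projectives_def by blast
    then show "\<exists>p. effective_descent C p \<and> Cod C p = B \<and> Dom C p \<in> X"
      using descent_projective_torsionfree[OF M] by blast
  qed
qed

end
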